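(* Let $\mathcal{P}$ be a countably infinite set of propositional variables and $\mathcal{A}$ a finite set of agents with $|\mathcal{A}|\geq 6$. The satisfiability problem of Arbitrary Arrow Update Logic (AAUL) — given a formula $\varphi\in\mathcal{L}_{\mathit{AAUL}}$, decide whether there exist a Kripke model $\mathcal{M}=(W,R,V)$ and a state $w\in W$ with $\mathcal{M},w\models\varphi$ — is co-RE hard (in particular, it is undecidable).
   Context: The language $\mathcal{L}_{\mathit{AAUL}}$ is generated by $\varphi ::= p \mid \neg\varphi \mid \varphi\wedge\varphi \mid \Box_a\varphi \mid [U]\varphi \mid [\Uparrow]\varphi$ and $U ::= (\varphi,a,\varphi) \mid U,(\varphi,a,\varphi)$, where $p\in\mathcal{P}$, $a\in\mathcal{A}$. An arrow update $U$ is thus a finite nonempty list (identified with the set) of clauses $(\varphi,a,\psi)$. The language $\mathcal{L}_{\mathit{AUL}}$ is the fragment of $\mathcal{L}_{\mathit{AAUL}}$ not containing $[\Uparrow]$. Other connectives and duals ($\vee,\to,\lozenge_a,\langle U\rangle,\langle\Uparrow\rangle$) are abbreviations as usual. A model is $\mathcal{M}=(W,R,V)$ with $W$ a set of states, $R:\mathcal{A}\to 2^{W\times W}$, $V:\mathcal{P}\to 2^W$ (the class of all Kripke models, no frame conditions). Satisfaction: $\mathcal{M},w\models p$ iff $w\in V(p)$; Boolean cases as usual; $\mathcal{M},w\models\Box_a\varphi$ iff $\mathcal{M},v\models\varphi$ for all $v$ with $(w,v)\in R(a)$; $\mathcal{M},w\models[U]\varphi$ iff $\mathcal{M}*U,w\models\varphi$;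 $\mathcal{M},w\models[\Uparrow]\varphi$ iff $\mathcal{M},w\models[U]\varphi$ for every arrow update $U$ all of whose clause formulas are in $\mathcal{L}_{\mathit{AUL}}$. Here $\mathcal{M}*U=(W,R^U,V)$ with $R^U(a)=\{(v,v')\in R(a)\mid \exists(\varphi,a,\varphi')\in U:\ \mathcal{M},v\models\varphi \text{ and } \mathcal{M},v'\models\varphi'\}$. A decision problem is co-RE hard if every problem whose complement is recursively enumerable is many-one reducible to it by a computable function. *)

theory Defs
  imports Main "HOL-Library.Countable_Set" "HOL-Library.Nat_Bijection"
begin

section \<open>Arbitrary arrow update logic\<close>

datatype ('p, 'a) fm =
    Atom 'p
  | Neg "('p, 'a) fm"
  | Conj "('p, 'a) fm" "('p, 'a) fm"
  | Box 'a "('p, 'a) fm"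
  | Upd "('p, 'a) upd" "('p, 'a) fm"
  | Arb "('p, 'a) fm"
and ('p, 'a) upd =
    Clause "('p, 'a) fm" 'a "('p, 'a) fm"
  | Snoc "('p, 'a) upd" "('p, 'a) fm" 'a "('p, 'a) fm"

primrec clauses :: "('p, 'a) upd \<Rightarrow> (('p, 'a) fm \<times> 'a \<times> ('p, 'a) fm) set" where
  "clauses (Clause \<phi> a \<psi>) = {(\<phi>, a, \<psi>)}"
| "clauses (Snoc U \<phi> a \<psi>) = insert (\<phi>, a, \<psi>) (clauses U)"

primrec AUL :: "('p, 'a) fm \<Rightarrow> bool" and AUL_upd :: "('p, 'a) upd \<Rightarrow> bool" where
  "AUL (Atom p) \<longleftrightarrow> True"
| "AUL (Neg \<phi>) \<longleftrightarrow> AUL \<phi>"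
| "AUL (Conj \<phi> \<psi>) \<longleftrightarrow> AUL \<phi> \<and> AUL \<psi>"
| "AUL (Box a \<phi>) \<longleftrightarrow> AUL \<phi>"
| "AUL (Upd U \<phi>) \<longleftrightarrow> AUL_upd U \<and> AUL \<phi>"
| "AUL (Arb \<phi>) \<longleftrightarrow> False"
| "AUL_upd (Clause \<phi> a \<psi>) \<longleftrightarrow> AUL \<phi> \<and> AUL \<psi>"
| "AUL_upd (Snoc U \<phi> a \<psi>) \<longleftrightarrow> AUL_upd U \<and> AUL \<phi> \<and> AUL \<psi>"

record ('w, 'a, 'p) model =
  worlds :: "'w set"
  rel :: "'a \<Rightarrow> ('w \<times> 'w) set"
  val :: "'p \<Rightarrow> 'w set"

definition kripke_model :: "('w, 'a, 'p) model \<Rightarrow> bool" where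
  "kripke_model M \<longleftrightarrow>
     (\<forall>a. rel M a \<subseteq> worlds M \<times> worlds M) \<and> (\<forall>p. val M p \<subseteq> worlds M)"

(* The number of occurrences of the arbitrary-update modality. It serves only the termination
   proof below: an update without this modality does not increase the count. *)
primrec arbs :: "('p, 'a) fm \<Rightarrow> nat" and arbs_upd :: "('p, 'a) upd \<Rightarrow> nat" where
  "arbs (Atom p) = 0"
| "arbs (Neg \<phi>) = arbs \<phi>"
| "arbs (Conj \<phi> \<psi>) = arbs \<phi> + arbs \<psi>"
| "arbs (Box a \<phi>) = arbs \<phi>"
| "arbs (Upd U \<phi>) = arbs_upd U + arbs \<phi>"
| "arbs (Arb \<phi>) = Suc (arbs \<phi>)"
| "arbs_upd (Clause \<phi> a \<psi>) = arbs \<phi> + arbs \<psi>"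
| "arbs_upd (Snoc U \<phi> a \<psi>) = arbs_upd U + arbs \<phi> + arbs \<psi>"

lemma AUL_arbs:
  fixes \<phi> :: "('p, 'a) fm" and U :: "('p, 'a) upd"
  shows "AUL \<phi> \<Longrightarrow> arbs \<phi> = 0" and "AUL_upd U \<Longrightarrow> arbs_upd U = 0"
  by (induction \<phi> and U rule: fm.induct upd.induct) auto

lemma clauses_smaller:
  assumes "(\<phi>, a, \<psi>) \<in> clauses U"
  shows "arbs \<phi> \<le> arbs_upd U" "arbs \<psi> \<le> arbs_upd U" "size \<phi> < size U" "size \<psi> < size U"
proof -
  have "(\<phi>, a, \<psi>) \<in> clauses U \<longrightarrow>
    arbs \<phi> \<le> arbs_upd U \<and> arbs \<psi> \<le> arbs_upd U \<and> size \<phi> < size U \<and> size \<psi> < size U"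
    by (rule upd.induct[of "\<lambda>_. True"]) auto
  with assms
  show "arbs \<phi> \<le> arbs_upd U" "arbs \<psi> \<le> arbs_upd U" "size \<phi> < size U" "size \<psi> < size U"
    by auto
qed

function (sequential) sat :: "('w, 'a, 'p) model \<Rightarrow> 'w \<Rightarrow> ('p, 'a) fm \<Rightarrow> bool"
  and update :: "('w, 'a, 'p) model \<Rightarrow> ('p, 'a) upd \<Rightarrow> ('w, 'a, 'p) model" where
  "sat M w (Atom p) \<longleftrightarrow> w \<in> val M p"
| "sat M w (Neg \<phi>) \<longleftrightarrow> \<not> sat M w \<phi>"
| "sat M w (Conj \<phi> \<psi>) \<longleftrightarrow> sat M w \<phi> \<and> sat M w \<psi>"
| "sat M w (Box a \<phi>) \<longleftrightarrow> (\<forall>v. (w, v) \<in> rel M a \<longrightarrow> sat M v \<phi>)"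
| "sat M w (Upd U \<phi>) \<longleftrightarrow> sat (update M U) w \<phi>"
| "sat M w (Arb \<phi>) \<longleftrightarrow> (\<forall>U. AUL_upd U \<longrightarrow> sat M w (Upd U \<phi>))"
| "update M U = \<lparr>worlds = worlds M,
     rel = (\<lambda>a. {(v, v'). (v, v') \<in> rel M a \<and>
                  (\<exists>(\<phi>, b, \<psi>) \<in> clauses U. b = a \<and> sat M v \<phi> \<and> sat M v' \<psi>)}),
     val = val M\<rparr>"
  by pat_completeness auto
termination
  by (relation "inv_image (less_than <*lex*> less_than)
       (\<lambda>x. case x of Inl (M, w, \<phi>) \<Rightarrow> (arbs \<phi>, size \<phi>) | Inr (M, U) \<Rightarrow> (arbs_upd U, size U))")
    (auto simp: AUL_arbs le_less dest: clauses_smaller)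

declare update.simps [simp del]

definition satisfiable :: "'w itself \<Rightarrow> ('p, 'a) fm \<Rightarrow> bool" where
  "satisfiable _ \<phi> \<longleftrightarrow>
     (\<exists>(M :: ('w, 'a, 'p) model) w. kripke_model M \<and> w \<in> worlds M \<and> sat M w \<phi>)"


section \<open>Codes of formulas\<close>

primrec fm_code :: "('p \<Rightarrow> nat) \<Rightarrow> ('a \<Rightarrow> nat) \<Rightarrow> ('p, 'a) fm \<Rightarrow> nat"
  and upd_code :: "('p \<Rightarrow> nat) \<Rightarrow> ('a \<Rightarrow> nat) \<Rightarrow> ('p, 'a) upd \<Rightarrow> nat" where
  "fm_code nP nA (Atom p) = prod_encode (0, nP p)"
| "fm_code nP nA (Neg \<phi>) = prod_encode (1, fm_code nP nA \<phi>)"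
| "fm_code nP nA (Conj \<phi> \<psi>) = prod_encode (2, prod_encode (fm_code nP nA \<phi>, fm_code nP nA \<psi>))"
| "fm_code nP nA (Box a \<phi>) = prod_encode (3, prod_encode (nA a, fm_code nP nA \<phi>))"
| "fm_code nP nA (Upd U \<phi>) = prod_encode (4, prod_encode (upd_code nP nA U, fm_code nP nA \<phi>))"
| "fm_code nP nA (Arb \<phi>) = prod_encode (5, fm_code nP nA \<phi>)"
| "upd_code nP nA (Clause \<phi> a \<psi>) =
     prod_encode (0, prod_encode (fm_code nP nA \<phi>, prod_encode (nA a, fm_code nP nA \<psi>)))"
| "upd_code nP nA (Snoc U \<phi> a \<psi>) =
     prod_encode (1, prod_encode (upd_code nP nA U,
       prod_encode (fm_code nP nA \<phi>, prod_encode (nA a, fm_code nP nA \<psi>))))"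

lemma code_eq:
  fixes \<phi> :: "('p, 'a) fm" and U :: "('p, 'a) upd"
  assumes "inj nP" "inj nA"
  shows "fm_code nP nA \<phi> = fm_code nP nA \<phi>' \<longrightarrow> \<phi> = \<phi>'"
    and "upd_code nP nA U = upd_code nP nA U' \<longrightarrow> U = U'"
proof (induction \<phi> and U arbitrary: \<phi>' and U' rule: fm.induct upd.induct)
  case (Atom p) show ?case using assms by (cases \<phi>') (auto dest: injD)
next
  case (Neg \<phi>) then show ?case by (cases \<phi>') auto
next
  case (Conj \<phi> \<psi>) then show ?case by (cases \<phi>') auto
next
  case (Box a \<phi>) then show ?case using assms by (cases \<phi>') (auto dest: injD)
next
  case (Upd U \<phi>) then show ?case by (cases \<phi>') auto
next
  case (Arb \<phi>) then show ?case by (cases \<phi>') auto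
next
  case (Clause \<phi> a \<psi>) then show ?case using assms by (cases U') (auto dest: injD)
next
  case (Snoc U \<phi> a \<psi>) then show ?case using assms by (cases U') (auto dest: injD)
qed

lemma inj_fm_code: "inj nP \<Longrightarrow> inj nA \<Longrightarrow> inj (fm_code nP nA)"
  and inj_upd_code: "inj nP \<Longrightarrow> inj nA \<Longrightarrow> inj (upd_code nP nA)"
  by (rule injI; use code_eq[of nP nA] in blast)+


section \<open>Independence of the type of states\<close>

text \<open>
  HOL cannot quantify over the type of states inside a formula. This is harmless: a formula
  satisfiable over some type of states is satisfiable over every infinite one (downward
  Loewenheim-Skolem), so over an infinite type \<open>satisfiable\<close> is satisfiability in the class of
  all Kripke models.
\<close>

definition restrict_model :: "('w, 'a, 'p) model \<Rightarrow> 'w set \<Rightarrow> ('w, 'a, 'p) model" where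
  "restrict_model M X = \<lparr>worlds = X, rel = (\<lambda>a. rel M a \<inter> X \<times> X), val = (\<lambda>p. val M p \<inter> X)\<rparr>"

lemma sat_restrict:
  fixes C :: "('w, 'a, 'p) model set"
  assumes upd: "\<And>M U. M \<in> C \<Longrightarrow> update M U \<in> C"
    and wit: "\<And>M a \<phi> w v. M \<in> C \<Longrightarrow> w \<in> X \<Longrightarrow> (w, v) \<in> rel M a \<Longrightarrow> \<not> sat M v \<phi> \<Longrightarrow>
                \<exists>v \<in> X. (w, v) \<in> rel M a \<and> \<not> sat M v \<phi>"
  shows "M \<in> C \<longrightarrow> w \<in> X \<longrightarrow> sat (restrict_model M X) w \<phi> = sat M w \<phi>"
    and "M \<in> C \<longrightarrow> update (restrict_model M X) U = restrict_model (update M U) X"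
proof (induction M w \<phi> and M U rule: sat_update.induct)
  case (4 M w a \<phi>)
  then show ?case using wit[of M w _ a \<phi>] by (auto simp: restrict_model_def)
next
  case (5 M w U \<phi>)
  then show ?case using upd by auto
next
  case (7 M U)
  show ?case
  proof
    assume "M \<in> C"
    have *: "sat (restrict_model M X) v \<phi> = sat M v \<phi>"
      "sat (restrict_model M X) v \<psi> = sat M v \<psi>"
      if "(\<phi>, b, \<psi>) \<in> clauses U" "v \<in> X" for \<phi> b \<psi> v
      using 7(1)[OF that(1) refl refl, of v] 7(2)[OF that(1) refl refl, of v] \<open>M \<in> C\<close> that(2)
      by simp_all
    have "(\<exists>(\<phi>, b, \<psi>) \<in> clauses U. b = a \<and> sat (restrict_model M X) v \<phi> \<and>
              sat (restrict_model M X) v' \<psi>) \<longleftrightarrow>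
          (\<exists>(\<phi>, b, \<psi>) \<in> clauses U. b = a \<and> sat M v \<phi> \<and> sat M v' \<psi>)"
      if "v \<in> X" "v' \<in> X" for v v' a
      using * that by (intro bex_cong) auto
    then have "rel (update (restrict_model M X) U) a = rel (restrict_model (update M U) X) a" for a
      unfolding update.simps by (fastforce simp: restrict_model_def)
    then show "update (restrict_model M X) U = restrict_model (update M U) X"
      by (intro model.equality ext) (auto simp: update.simps restrict_model_def)
  qed
qed (auto simp: restrict_model_def)

definition image_model :: "('w \<Rightarrow> 'v) \<Rightarrow> ('w, 'a, 'p) model \<Rightarrow> ('v, 'a, 'p) model" where
  "image_model f M =
     \<lparr>worlds = f ` worlds M, rel = (\<lambda>a. map_prod f f ` rel M a), val = (\<lambda>p. f ` val M p)\<rparr>"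

lemma kripke_model_update: "kripke_model M \<Longrightarrow> kripke_model (update M U)"
  by (auto simp: kripke_model_def update.simps)

lemma sat_image:
  shows "kripke_model M \<longrightarrow> inj_on f (worlds M) \<longrightarrow> w \<in> worlds M \<longrightarrow>
           sat (image_model f M) (f w) \<phi> = sat M w \<phi>"
    and "kripke_model M \<longrightarrow> inj_on f (worlds M) \<longrightarrow>
           update (image_model f M) U = image_model f (update M U)"
proof (induction M w \<phi> and M U rule: sat_update.induct)
  case (1 M w p)
  have "f w \<in> f ` val M p \<longleftrightarrow> w \<in> val M p"
    if "kripke_model M" "inj_on f (worlds M)" "w \<in> worlds M"
    using that by (auto simp: kripke_model_def inj_on_image_mem_iff)
  then show ?case by (simp add: image_model_def)
next
  case (4 M w a \<phi>)
  show ?case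
  proof (intro impI)
    assume M: "kripke_model M" "inj_on f (worlds M)" "w \<in> worlds M"
    then have "(f w, u) \<in> rel (image_model f M) a \<longleftrightarrow> (\<exists>v. u = f v \<and> (w, v) \<in> rel M a)" for u
      by (force simp: image_model_def kripke_model_def map_prod_def dest: inj_onD)
    moreover have "v \<in> worlds M" if "(w, v) \<in> rel M a" for v
      using M that by (auto simp: kripke_model_def)
    ultimately show "sat (image_model f M) (f w) (Box a \<phi>) = sat M w (Box a \<phi>)"
      using 4 M by auto
  qed
next
  case (5 M w U \<phi>)
  then show ?case using kripke_model_update[of M U] by (auto simp: update.simps)
next
  case (7 M U)
  show ?case
  proof (intro impI)
    assume M: "kripke_model M" "inj_on f (worlds M)"
    have *: "sat (image_model f M) (f v) \<phi> = sat M v \<phi>"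
      "sat (image_model f M) (f v) \<psi> = sat M v \<psi>"
      if "(\<phi>, b, \<psi>) \<in> clauses U" "v \<in> worlds M" for \<phi> b \<psi> v
      using 7(1)[OF that(1) refl refl, of v] 7(2)[OF that(1) refl refl, of v] M that(2)
      by simp_all
    have "(\<exists>(\<phi>, b, \<psi>) \<in> clauses U. b = a \<and> sat (image_model f M) (f v) \<phi> \<and>
              sat (image_model f M) (f v') \<psi>) \<longleftrightarrow>
          (\<exists>(\<phi>, b, \<psi>) \<in> clauses U. b = a \<and> sat M v \<phi> \<and> sat M v' \<psi>)"
      if "(v, v') \<in> rel M a" for v v' a
    proof -
      have "v \<in> worlds M" "v' \<in> worlds M" using M that by (auto simp: kripke_model_def)
      then show ?thesis using * by (intro bex_cong) auto
    qed
    then have "rel (update (image_model f M) U) a = rel (image_model f (update M U)) a" for a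
      unfolding update.simps image_model_def by fastforce
    then show "update (image_model f M) U = image_model f (update M U)"
      by (intro model.equality ext) (auto simp: update.simps image_model_def)
  qed
qed auto

theorem satisfiable_state_type:
  fixes \<phi> :: "('p, 'a) fm"
  assumes "countable (UNIV :: 'p set)" "countable (UNIV :: 'a set)"
    and infinite: "infinite (UNIV :: 'w set)"
    and "satisfiable TYPE('v) \<phi>"
  shows "satisfiable TYPE('w) \<phi>"
proof -
  have "inj_on (fm_code (to_nat_on UNIV) (to_nat_on UNIV)) (UNIV :: ('p, 'a) fm set)"
    "inj_on (upd_code (to_nat_on UNIV) (to_nat_on UNIV)) (UNIV :: ('p, 'a) upd set)"
    using assms(1,2) by (auto intro!: inj_fm_code inj_upd_code)
  then have fms: "countable (UNIV :: ('p, 'a) fm set)"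
    and upds: "countable (UNIV :: ('p, 'a) upd set)"
    by (blast intro: countableI)+
  obtain M :: "('v, 'a, 'p) model" and w where
    M: "kripke_model M" "w \<in> worlds M" "sat M w \<phi>"
    using assms(4) by (auto simp: satisfiable_def)
  define C where "C = range (foldl update M)"
  have "foldl update M [] \<in> C" unfolding C_def by (rule rangeI)
  then have C1: "M \<in> C" by simp
  have C2: "update N U \<in> C" if "N \<in> C" for N U
  proof -
    obtain Us where "N = foldl update M Us" using \<open>N \<in> C\<close> by (auto simp: C_def)
    then have "update N U = foldl update M (Us @ [U])" by simp
    then show ?thesis unfolding C_def by (metis rangeI)
  qed
  have "countable (lists (UNIV :: ('p, 'a) upd set))" using upds by (rule countable_lists)
  then have "countable C" unfolding C_def lists_UNIV by simp
  define wit :: "('v, 'a, 'p) model \<times> 'a \<times> ('p, 'a) fm \<Rightarrow> 'v \<Rightarrow> 'v"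
    where "wit = (\<lambda>(N, a, \<psi>) u. SOME v. (u, v) \<in> rel N a \<and> \<not> sat N v \<psi>)"
  define step where "step = (\<lambda>X. X \<union> (\<Union>k \<in> C \<times> UNIV \<times> UNIV. wit k ` X))"
  define X where "X = (\<Union>n. (step ^^ n) {w})"
  have "countable ((step ^^ n) {w})" for n
  proof (induction n)
    case (Suc n)
    have "countable (C \<times> (UNIV :: 'a set) \<times> (UNIV :: ('p, 'a) fm set))"
      using \<open>countable C\<close> assms(2) fms by (intro countable_SIGMA)
    with Suc show ?case by (simp add: step_def)
  qed simp
  then have "countable X" by (simp add: X_def)
  have "w \<in> (step ^^ 0) {w}" by simp
  then have "w \<in> X" unfolding X_def by blast
  have X: "\<exists>v \<in> X. (u, v) \<in> rel N a \<and> \<not> sat N v \<psi>"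
    if "N \<in> C" "u \<in> X" "(u, v) \<in> rel N a" "\<not> sat N v \<psi>" for N a \<psi> u v
  proof -
    obtain n where "u \<in> (step ^^ n) {w}" using \<open>u \<in> X\<close> by (auto simp: X_def)
    then have "wit (N, a, \<psi>) u \<in> (step ^^ Suc n) {w}" using \<open>N \<in> C\<close> by (auto simp: step_def)
    then have "wit (N, a, \<psi>) u \<in> X" unfolding X_def by blast
    moreover have "(u, wit (N, a, \<psi>) u) \<in> rel N a \<and> \<not> sat N (wit (N, a, \<psi>) u) \<psi>"
      unfolding wit_def prod.case by (rule someI[of _ v]) (use that in auto)
    ultimately show ?thesis by blast
  qed
  have "M \<in> C \<longrightarrow> w \<in> X \<longrightarrow> sat (restrict_model M X) w \<phi> = sat M w \<phi>"
    by (rule sat_restrict(1)) (fact C2, fact X)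
  then have "sat (restrict_model M X) w \<phi>" using C1 \<open>w \<in> X\<close> M(3) by blast
  moreover have "kripke_model (restrict_model M X)"
    by (auto simp: kripke_model_def restrict_model_def)
  moreover obtain g :: "nat \<Rightarrow> 'w" where "inj g"
    using infinite infinite_countable_subset by blast
  then have "inj_on (g \<circ> to_nat_on X) X"
    using \<open>countable X\<close> by (auto intro!: comp_inj_on inj_on_to_nat_on intro: inj_on_subset)
  ultimately have "sat (image_model (g \<circ> to_nat_on X) (restrict_model M X)) ((g \<circ> to_nat_on X) w) \<phi>"
    using sat_image(1)[of "restrict_model M X" "g \<circ> to_nat_on X" w \<phi>] \<open>w \<in> X\<close>
    by (auto simp: restrict_model_def)
  then show ?thesis
    unfolding satisfiable_def using \<open>w \<in> X\<close>
    by (intro exI conjI) (auto simp: kripke_model_def image_model_def restrict_model_def)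
qed


section \<open>Computability on the natural numbers\<close>

datatype recf =
    Zero
  | Succ
  | Proj nat
  | Comp recf "recf list"
  | Prec recf recf
  | Mu recf

(* Arguments are passed as a list; primitive recursion and minimisation act on its head. *)
inductive evals :: "recf \<Rightarrow> nat list \<Rightarrow> nat \<Rightarrow> bool" where
  "evals Zero xs 0"
| "evals Succ [x] (Suc x)"
| "i < length xs \<Longrightarrow> evals (Proj i) xs (xs ! i)"
| "list_all2 (\<lambda>g y. evals g xs y) gs ys \<Longrightarrow> evals f ys z \<Longrightarrow> evals (Comp f gs) xs z"
| "evals f xs y \<Longrightarrow> evals (Prec f g) (0 # xs) y"
| "evals (Prec f g) (n # xs) y \<Longrightarrow> evals g (n # y # xs) z \<Longrightarrow> evals (Prec f g) (Suc n # xs) z"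
| "evals f (n # xs) 0 \<Longrightarrow> (\<And>m. m < n \<Longrightarrow> \<exists>y>0. evals f (m # xs) y) \<Longrightarrow> evals (Mu f) xs n"

definition computable :: "(nat \<Rightarrow> nat) \<Rightarrow> bool" where
  "computable f \<longleftrightarrow> (\<exists>r. \<forall>n y. evals r [n] y \<longleftrightarrow> y = f n)"

definition recursively_enumerable :: "nat set \<Rightarrow> bool" where
  "recursively_enumerable A \<longleftrightarrow> (\<exists>r. \<forall>n. n \<in> A \<longleftrightarrow> (\<exists>y. evals r [n] y))"

definition decidable :: "nat set \<Rightarrow> bool" where
  "decidable A \<longleftrightarrow> computable (\<lambda>n. if n \<in> A then 1 else 0)"

definition many_one_reducible :: "nat set \<Rightarrow> nat set \<Rightarrow> bool" where
  "many_one_reducible A B \<longleftrightarrow> (\<exists>f. computable f \<and> (\<forall>n. n \<in> A \<longleftrightarrow> f n \<in> B))"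

definition co_RE_hard :: "nat set \<Rightarrow> bool" where
  "co_RE_hard B \<longleftrightarrow> (\<forall>A. recursively_enumerable (- A) \<longrightarrow> many_one_reducible A B)"

end

(*
  Each grid point has a private atom. At a world v, the formula "seen" says that some update leaves
  v with a path to the root and from there to a world that no further update separates from v. As
  updates never change atoms, in the intended grid model that world is v itself, so seen holds at v
  in an updated model only if the arrow from the root to v has survived. Hence the formula
  [Arb](dia_s dia_a (X & seen) -> dia_s X) is true in the grid model although arbitrary updates
  also delete arrows. In an arbitrary model, "seen" survives the updates that only mark an arbitrary
  set X, so the formula forces, for every \<phi> without arbitrary updates, that \<phi> holds at all
  a-successors of s-successors of the root if it holds at all s-successors. This yields a universal
  modality, under which determinism and commutation of the two grid directions are expressible
  directly. Rows of the grid then encode the configurations of a program with unary registers, and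
  the formula is satisfiable iff the program diverges.

  Undecidability needs one undecidable recursively enumerable set. Evaluation of codes of recursive
  functions is shown to be recursively enumerable by searching for a finite set of facts in which
  every fact follows by an evaluation rule from other facts of the set. Such a set is sound because
  the rules decrease either the function or the recursion argument.
*)
theory Submission
  imports Defs "HOL-Library.Countable"
begin

section \<open>Recursive functions\<close>

inductive_cases evals_ZeroE: "evals Zero xs y"
inductive_cases evals_SuccE: "evals Succ xs y"
inductive_cases evals_ProjE: "evals (Proj i) xs y"
inductive_cases evals_CompE: "evals (Comp f gs) xs y"
inductive_cases evals_PrecE: "evals (Prec f g) xs y"
inductive_cases evals_MuE: "evals (Mu f) xs y"

text \<open>The inductive relation \<open>evals\<close> does not display that it is a partial
  function. Both \<open>computable\<close>, which asks for exactly one value, and the recursion and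
  minimisation cases of the compiler rely on it.\<close>

lemma evals_det: "evals r xs y \<Longrightarrow> evals r xs z \<Longrightarrow> y = z"
proof (induction arbitrary: z rule: evals.induct)
  case (4 xs gs ys f z')
  from 4(4) obtain ys' where ys': "list_all2 (\<lambda>g y. evals g xs y) gs ys'" "evals f ys' z"
    by (rule evals_CompE)
  have "ys = ys'"
    using 4(1) ys'(1) unfolding list_all2_conv_all_nth by (auto intro: nth_equalityI)
  with 4(2) ys'(2) show ?case by blast
next
  case (5 f xs y g)
  from 5(3) have "evals f xs z" by (auto elim: evals_PrecE)
  with 5(2) show ?case by blast
next
  case (6 f g n xs y z')
  from 6(5) obtain y' where "evals (Prec f g) (n # xs) y'" "evals g (n # y' # xs) z"
    by (auto elim: evals_PrecE)
  with 6 show ?case by blast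
next
  case (7 f n xs)
  from 7(4) have z: "evals f (z # xs) 0" "\<And>m. m < z \<Longrightarrow> \<exists>y>0. evals f (m # xs) y"
    by (auto elim: evals_MuE)
  show ?case
  \<comment> \<open>If two minima differed, the function would have both the value 0 and a positive
    value at the smaller one.\<close>
  proof (rule linorder_cases)
    assume "n < z" with z(2) 7(2) show ?thesis by fastforce
  next
    assume "z < n" with z(1) 7(3) show ?thesis by fastforce
  qed
qed (auto elim: evals_ZeroE evals_SuccE evals_ProjE)

section \<open>Total recursive functions and decidable predicates\<close>

definition total_rec :: "nat \<Rightarrow> (nat list \<Rightarrow> nat) \<Rightarrow> bool" where
  "total_rec k F \<longleftrightarrow> (\<exists>r. \<forall>xs. length xs = k \<longrightarrow> evals r xs (F xs))"

abbreviation dec :: "nat \<Rightarrow> (nat list \<Rightarrow> bool) \<Rightarrow> bool" where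
  "dec k P \<equiv> total_rec k (\<lambda>v. of_bool (P v))"

lemma total_rec_cong: "(\<And>v. length v = k \<Longrightarrow> F v = G v) \<Longrightarrow> total_rec k F = total_rec k G"
  by (auto simp: total_rec_def)

lemma total_rec_nth: "i < k \<Longrightarrow> total_rec k (\<lambda>v. v ! i)"
  unfolding total_rec_def by (rule exI[of _ "Proj i"]) (auto intro: evals.intros)

lemma total_rec_comp:
  assumes "total_rec (length Gs) F" and "\<And>G. G \<in> set Gs \<Longrightarrow> total_rec k G"
  shows "total_rec k (\<lambda>v. F (map (\<lambda>G. G v) Gs))"
proof -
  obtain f where f: "\<And>xs. length xs = length Gs \<Longrightarrow> evals f xs (F xs)"
    using assms(1) by (auto simp: total_rec_def)
  obtain g where g: "\<And>G xs. G \<in> set Gs \<Longrightarrow> length xs = k \<Longrightarrow> evals (g G) xs (G xs)"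
    using assms(2) unfolding total_rec_def by metis
  have "evals (Comp f (map g Gs)) xs (F (map (\<lambda>G. G xs) Gs))" if "length xs = k" for xs
    using f g that by (auto intro!: evals.intros(4)[where ys = "map (\<lambda>G. G xs) Gs"] simp: list_all2_conv_all_nth)
  then show ?thesis unfolding total_rec_def by blast
qed

lemma total_rec_comp1:
  assumes "total_rec 1 (\<lambda>v. f (v ! 0))" and "total_rec k F"
  shows "total_rec k (\<lambda>v. f (F v))"
proof -
  have "total_rec k (\<lambda>v. f (map (\<lambda>G. G v) [F] ! 0))"
    by (rule total_rec_comp) (use assms in auto)
  then show ?thesis by simp
qed

lemma total_rec_comp2:
  assumes "total_rec 2 (\<lambda>v. f (v ! 0) (v ! 1))" and "total_rec k F" and "total_rec k G"
  shows "total_rec k (\<lambda>v. f (F v) (G v))"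
proof -
  have "total_rec k (\<lambda>v. f (map (\<lambda>G. G v) [F, G] ! 0) (map (\<lambda>G. G v) [F, G] ! 1))"
    by (rule total_rec_comp[where F = "\<lambda>v. f (v ! 0) (v ! 1)"])
      (use assms in \<open>auto simp: numeral_2_eq_2\<close>)
  then show ?thesis by simp
qed

lemma total_rec_Suc: "total_rec k F \<Longrightarrow> total_rec k (\<lambda>v. Suc (F v))"
proof (rule total_rec_comp1[where f = Suc])
  have "evals Succ xs (Suc (xs ! 0))" if "length xs = 1" for xs
    using that by (cases xs) (auto intro: evals.intros)
  then show "total_rec 1 (\<lambda>v. Suc (v ! 0))" unfolding total_rec_def by blast
qed

lemma total_rec_const: "total_rec k (\<lambda>v. c)"
proof (induction c)
  case 0
  then show ?case unfolding total_rec_def by (auto intro: evals.intros)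
qed (rule total_rec_Suc)

text \<open>\<open>Prec\<close> recurses on the head of its argument list, so the parameters stay
  behind the counter and \<open>N\<close> is put in front by composition. \<open>G\<close> and
  \<open>H\<close> are one function in two forms: \<open>G\<close> suits \<open>rec_nat\<close>
  terms, while \<open>H\<close>, acting on the whole list, is what the closure rules treat.\<close>

lemma total_rec_rec_nat:
  assumes N: "total_rec k N" and F: "total_rec k F"
    and H: "total_rec (Suc (Suc k)) H"
    and HG: "\<And>n y v. length v = k \<Longrightarrow> H (n # y # v) = G n y v"
  shows "total_rec k (\<lambda>v. rec_nat (F v) (\<lambda>n y. G n y v) (N v))"
proof -
  obtain f where f: "\<And>xs. length xs = k \<Longrightarrow> evals f xs (F xs)"
    using F by (auto simp: total_rec_def)
  obtain g where g: "\<And>xs. length xs = Suc (Suc k) \<Longrightarrow> evals g xs (H xs)"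
    using H by (auto simp: total_rec_def)
  have "evals (Prec f g) (n # xs) (rec_nat (F xs) (\<lambda>n y. G n y xs) n)" if "length xs = k" for n xs
  proof (induction n)
    case 0
    show ?case using f[OF that] by (auto intro: evals.intros)
  next
    case (Suc n)
    show ?case
      using g[of "n # rec_nat (F xs) (\<lambda>n y. G n y xs) n # xs"] that
      by (auto intro!: evals.intros(6)[OF Suc] simp: HG)
  qed
  then have "total_rec (Suc k) (\<lambda>v. rec_nat (F (tl v)) (\<lambda>n y. G n y (tl v)) (hd v))"
    unfolding total_rec_def
    by (intro exI[of _ "Prec f g"]) (auto simp: length_Suc_conv)
  then have "total_rec k (\<lambda>v. (\<lambda>v. rec_nat (F (tl v)) (\<lambda>n y. G n y (tl v)) (hd v))
      (map (\<lambda>G. G v) (N # map (\<lambda>i v. v ! i) [0..<k])))"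
    by (intro total_rec_comp) (auto intro: N total_rec_nth)
  moreover have "map (\<lambda>i. v ! i) [0..<k] = v" if "length v = k" for v :: "nat list"
    using that map_nth[of v] by simp
  ultimately show ?thesis
    by (subst total_rec_cong) (auto simp: o_def)
qed

lemma total_rec_add: "total_rec k F \<Longrightarrow> total_rec k G \<Longrightarrow> total_rec k (\<lambda>v. F v + G v)"
proof -
  assume *: "total_rec k F" "total_rec k G"
  have "rec_nat b (\<lambda>_. Suc) a = a + b" for a b by (induction a) auto
  then show ?thesis
    using total_rec_rec_nat[OF *, of "\<lambda>v. Suc (v ! 1)" "\<lambda>_ y _. Suc y"]
    by (simp add: total_rec_Suc total_rec_nth)
qed

lemma total_rec_mult: "total_rec k F \<Longrightarrow> total_rec k G \<Longrightarrow> total_rec k (\<lambda>v. F v * G v)"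
proof (rule total_rec_comp2[where f = "(*)"])
  have "rec_nat 0 (\<lambda>_ y. b + y) a = a * b" for a b :: nat by (induction a) auto
  then show "total_rec 2 (\<lambda>v. v ! 0 * v ! 1)"
    using total_rec_rec_nat[of 2 "\<lambda>v. v ! 0" "\<lambda>v. 0" "\<lambda>v. v ! 3 + v ! 1" "\<lambda>_ y v. v ! 1 + y"]
    by (simp add: total_rec_nth total_rec_const total_rec_add numeral_3_eq_3)
qed

lemma total_rec_pred: "total_rec k F \<Longrightarrow> total_rec k (\<lambda>v. F v - 1)"
proof -
  assume *: "total_rec k F"
  have "rec_nat 0 (\<lambda>n _. n) a = a - 1" for a by (induction a) auto
  then show ?thesis
    using total_rec_rec_nat[OF * total_rec_const, of "\<lambda>v. v ! 0" "\<lambda>n _ _. n" 0]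
    by (simp add: total_rec_nth)
qed

lemma total_rec_diff: "total_rec k F \<Longrightarrow> total_rec k G \<Longrightarrow> total_rec k (\<lambda>v. F v - G v)"
proof -
  assume *: "total_rec k F" "total_rec k G"
  have "rec_nat a (\<lambda>_ y. y - 1) b = a - b" for a b :: nat by (induction b) auto
  then show ?thesis
    using total_rec_rec_nat[OF *(2,1), of "\<lambda>v. v ! 1 - 1" "\<lambda>_ y _. y - 1"]
      total_rec_pred[OF total_rec_nth, of 1 "Suc (Suc k)"] by simp
qed

lemmas total_rec_arith =
  total_rec_nth total_rec_const total_rec_Suc total_rec_add total_rec_mult total_rec_diff

lemma dec_not: "dec k P \<Longrightarrow> dec k (\<lambda>v. \<not> P v)"
proof -
  assume *: "dec k P"
  have eq: "of_bool (\<not> p) = 1 - (of_bool p :: nat)" for p by simp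
  show ?thesis unfolding eq by (intro total_rec_arith *)
qed

lemma dec_conj:
  assumes "dec k P" and "dec k Q"
  shows "dec k (\<lambda>v. P v \<and> Q v)"
  unfolding of_bool_conj by (intro total_rec_mult assms)

lemma dec_disj:
  assumes "dec k P" and "dec k Q"
  shows "dec k (\<lambda>v. P v \<or> Q v)"
proof -
  have eq: "P v \<or> Q v \<longleftrightarrow> \<not> (\<not> P v \<and> \<not> Q v)" for v by blast
  show ?thesis unfolding eq by (intro dec_not dec_conj assms)
qed

lemma dec_eq: "total_rec k F \<Longrightarrow> total_rec k G \<Longrightarrow> dec k (\<lambda>v. F v = G v)"
proof -
  assume *: "total_rec k F" "total_rec k G"
  have eq: "of_bool (a = b) = 1 - ((a - b) + (b - a))" for a b :: nat by auto
  show ?thesis unfolding eq by (intro total_rec_arith *)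
qed

lemma total_rec_if:
  assumes "dec k P" "total_rec k F" "total_rec k G"
  shows "total_rec k (\<lambda>v. if P v then F v else G v)"
proof -
  have eq: "(if P v then F v else G v) = of_bool (P v) * F v + of_bool (\<not> P v) * G v" for v by simp
  show ?thesis unfolding eq by (intro total_rec_arith dec_not assms)
qed

text \<open>Bounded search is primitive recursion on the bound: the accumulator becomes 1 at the
  first witness and stays 1.\<close>

lemma dec_bex:
  assumes B: "total_rec k B" and Q: "dec (Suc k) Q"
    and QP: "\<And>x v. length v = k \<Longrightarrow> Q (x # v) = P x v"
  shows "dec k (\<lambda>v. \<exists>x<B v. P x v)"
proof -
  let ?H = "\<lambda>v. if Q (v ! 0 # drop 2 v) then 1 else v ! 1"
  let ?Gs = "map (\<lambda>i v. v ! i) (0 # [2..<Suc (Suc k)])"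
  \<comment> \<open>The recursion step sees counter, accumulator and parameters; the projections
    skip index 1, the accumulator, before \<open>Q\<close> is applied.\<close>
  have "dec (Suc (Suc k)) (\<lambda>v. Q (map (\<lambda>G. G v) ?Gs))"
    by (rule total_rec_comp) (use Q in \<open>auto intro: total_rec_nth simp del: upt_Suc\<close>)
  moreover have "map (\<lambda>G. G v) ?Gs = v ! 0 # drop 2 v" if "length v = Suc (Suc k)" for v :: "nat list"
    using that by (intro nth_equalityI) (auto simp: nth_Cons split: nat.split simp del: upt_Suc)
  ultimately have "dec (Suc (Suc k)) (\<lambda>v. Q (v ! 0 # drop 2 v))"
    by (subst total_rec_cong) auto
  then have "total_rec (Suc (Suc k)) ?H"
    by (intro total_rec_if total_rec_arith) auto
  then have "total_rec k (\<lambda>v. rec_nat 0 (\<lambda>n y. if P n v then 1 else y) (B v))"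
    by (rule total_rec_rec_nat[OF B total_rec_const]) (auto simp: QP numeral_2_eq_2)
  moreover have "rec_nat (0::nat) (\<lambda>n y. if P n v then 1 else y) b = of_bool (\<exists>x<b. P x v)" for b v
    by (induction b) (auto simp: less_Suc_eq)
  ultimately show ?thesis by simp
qed

section \<open>Computable functions and recursively enumerable sets\<close>

lemma total_rec_imp_computable: "total_rec 1 (\<lambda>v. f (v ! 0)) \<Longrightarrow> computable f"
proof -
  assume "total_rec 1 (\<lambda>v. f (v ! 0))"
  then obtain r where r: "\<And>xs. length xs = 1 \<Longrightarrow> evals r xs (f (xs ! 0))"
    by (auto simp: total_rec_def)
  then have "evals r [n] (f n)" for n by (metis One_nat_def length_Cons list.size(3) nth_Cons_0)
  then show ?thesis unfolding computable_def using evals_det by blast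
qed

lemma computable_imp_total_rec:
  assumes "computable f"
  shows "total_rec 1 (\<lambda>v. f (v ! 0))"
proof -
  obtain r where r: "\<forall>n. evals r [n] (f n)" using assms unfolding computable_def by metis
  have "evals r xs (f (xs ! 0))" if "length xs = 1" for xs
  proof -
    obtain x where "xs = [x]" using \<open>length xs = 1\<close> by (cases xs) auto
    then show ?thesis using r by simp
  qed
  then show ?thesis unfolding total_rec_def by blast
qed

text \<open>\<open>Mu\<close> looks for a zero, so it is applied to the characteristic function of
  the negation of \<open>P\<close>; it has a value iff some \<open>m\<close> is a witness.\<close>

lemma recursively_enumerable_ex:
  assumes "dec 2 (\<lambda>v. P (v ! 0) (v ! 1))"
  shows "recursively_enumerable {n. \<exists>m. P m n}"
proof -
  obtain r where r: "\<And>xs. length xs = 2 \<Longrightarrow> evals r xs (of_bool (\<not> P (xs ! 0) (xs ! 1)))"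
    using dec_not[OF assms] by (auto simp: total_rec_def)
  have r: "evals r [m, n] y \<longleftrightarrow> y = of_bool (\<not> P m n)" for m n y
    using r[of "[m, n]"] evals_det by auto
  have "(\<exists>y. evals (Mu r) [n] y) \<longleftrightarrow> (\<exists>m. P m n)" for n
  proof
    assume "\<exists>y. evals (Mu r) [n] y"
    then obtain y where "evals (Mu r) [n] y" by blast
    then have "evals r [y, n] 0" by (rule evals_MuE)
    then show "\<exists>m. P m n" by (auto simp: r)
  next
    assume ex: "\<exists>m. P m n"
    have "evals (Mu r) [n] (LEAST m. P m n)"
      using LeastI_ex[OF ex] by (auto intro!: evals.intros simp: r dest: not_less_Least)
    then show "\<exists>y. evals (Mu r) [n] y" ..
  qed
  then show ?thesis unfolding recursively_enumerable_def by (intro exI[of _ "Mu r"]) auto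
qed

subsection \<open>Pairs and finite sets of numbers\<close>

lemma total_rec_prod_encode:
  assumes "total_rec k F" and "total_rec k G"
  shows "total_rec k (\<lambda>v. prod_encode (F v, G v))"
proof -
  have tri: "triangle n = rec_nat 0 (\<lambda>n y. y + Suc n) n" for n by (induction n) auto
  have "total_rec k (\<lambda>v. rec_nat 0 (\<lambda>n y. y + Suc n) (F v + G v))"
    by (rule total_rec_rec_nat[where H = "\<lambda>v. v ! 1 + Suc (v ! 0)"])
      (auto intro!: total_rec_arith assms)
  then have "total_rec k (\<lambda>v. triangle (F v + G v))" unfolding tri .
  then show ?thesis unfolding prod_encode_def prod.case by (intro total_rec_add assms)
qed

definition pr1 :: "nat \<Rightarrow> nat" where "pr1 n = fst (prod_decode n)"
definition pr2 :: "nat \<Rightarrow> nat" where "pr2 n = snd (prod_decode n)"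

lemma pr_prod_encode [simp]: "pr1 (prod_encode (a, b)) = a" "pr2 (prod_encode (a, b)) = b"
  by (simp_all add: pr1_def pr2_def)

lemma prod_encode_pr [simp]: "prod_encode (pr1 n, pr2 n) = n"
  by (simp add: pr1_def pr2_def)

lemma pr_le: "pr1 n \<le> n" "pr2 n \<le> n"
  using le_prod_encode_1[of "pr1 n" "pr2 n"] le_prod_encode_2[of "pr2 n" "pr1 n"] by simp_all

text \<open>If \<open>f n\<close> is at most \<open>n\<close>, trying all candidates up to
  \<open>n\<close> in a decidable graph finds it. This inverts the pairing function without an
  explicit formula.\<close>

lemma total_rec_least:
  assumes P: "dec 2 (\<lambda>v. P (v ! 0) (v ! 1))" and f: "\<And>n a. P n a \<longleftrightarrow> a = f n" and le: "\<And>n. f n \<le> n"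
  shows "total_rec 1 (\<lambda>v. f (v ! 0))"
proof -
  \<comment> \<open>In lists of length 3, index 0 is the candidate, 1 the accumulator and 2 the
    argument.\<close>
  have "dec 3 (\<lambda>v. P (v ! 2) (v ! 0))"
    by (rule total_rec_comp2[where f = "\<lambda>n a. of_bool (P n a)", OF P]) (simp_all add: total_rec_nth)
  then have "total_rec 1 (\<lambda>v. rec_nat 0 (\<lambda>a y. if P (v ! 0) a then a else y) (Suc (v ! 0)))"
    by (intro total_rec_rec_nat[where H = "\<lambda>v. if P (v ! 2) (v ! 0) then v ! 0 else v ! 1"]
        total_rec_if total_rec_arith) (auto simp: numeral_3_eq_3 numeral_2_eq_2)
  moreover have "rec_nat 0 (\<lambda>a y. if P n a then a else y) m = (if f n < m then f n else 0)" for m n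
    by (induction m) (auto simp: f)
  then have "rec_nat 0 (\<lambda>a y. if P n a then a else y) (Suc n) = f n" for n
    using le[of n] by (simp add: less_Suc_eq_le del: nat.rec)
  ultimately show ?thesis by simp
qed

lemma total_rec_pr:
  assumes "total_rec k F"
  shows "total_rec k (\<lambda>v. pr1 (F v))" and "total_rec k (\<lambda>v. pr2 (F v))"
proof -
  have dec: "dec 3 (\<lambda>v. prod_encode (v ! i, v ! j) = v ! 1)" if "i < 3" "j < 3" for i j
    using that by (intro dec_eq total_rec_prod_encode total_rec_arith) auto
  have "dec 2 (\<lambda>v. \<exists>x<Suc (v ! 0). prod_encode (v ! 1, x) = v ! 0)"
    by (rule dec_bex[where Q = "\<lambda>v. prod_encode (v ! 2, v ! 0) = v ! 1"])
      (use dec[of 2 0] in \<open>auto simp: numeral_3_eq_3 numeral_2_eq_2 intro!: total_rec_arith\<close>)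
  moreover have "dec 2 (\<lambda>v. \<exists>x<Suc (v ! 0). prod_encode (x, v ! 1) = v ! 0)"
    by (rule dec_bex[where Q = "\<lambda>v. prod_encode (v ! 0, v ! 2) = v ! 1"])
      (use dec[of 0 2] in \<open>auto simp: numeral_3_eq_3 numeral_2_eq_2 intro!: total_rec_arith\<close>)
  moreover have "(\<exists>x<Suc n. prod_encode (a, x) = n) \<longleftrightarrow> a = pr1 n"
    "(\<exists>x<Suc n. prod_encode (x, a) = n) \<longleftrightarrow> a = pr2 n" for n a
    using pr_le[of n] by (metis le_imp_less_Suc pr_prod_encode prod_encode_pr)+
  ultimately have "dec 2 (\<lambda>v. v ! 1 = pr1 (v ! 0))" "dec 2 (\<lambda>v. v ! 1 = pr2 (v ! 0))"
    by (simp_all only:)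
  note dec = this
  have "total_rec 1 (\<lambda>v. pr1 (v ! 0))" by (rule total_rec_least[OF dec(1) refl pr_le(1)])
  moreover have "total_rec 1 (\<lambda>v. pr2 (v ! 0))" by (rule total_rec_least[OF dec(2) refl pr_le(2)])
  ultimately show "total_rec k (\<lambda>v. pr1 (F v))" "total_rec k (\<lambda>v. pr2 (F v))"
    using assms by (auto intro: total_rec_comp1)
qed

lemma dec_set_decode:
  assumes "total_rec k F" and "total_rec k G"
  shows "dec k (\<lambda>v. F v \<in> set_decode (G v))"
proof -
  \<comment> \<open>Halving uses (n + 1) div 2 = n - n div 2; iterating it shifts the binary
    expansion, whose last digit then decides membership.\<close>
  have half: "rec_nat 0 (\<lambda>n y. n - y) n = n div 2" for n by (induction n) auto
  have iter: "rec_nat d (\<lambda>_ y. y div 2) x = d div 2 ^ x" for d x :: nat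
  proof (induction x)
    case (Suc x)
    have "d div 2 ^ Suc x = d div 2 ^ x div 2" by (metis div_mult2_eq power_Suc2)
    with Suc show ?case by simp
  qed simp
  have div2: "total_rec k (\<lambda>v. H v div 2)" if "total_rec k H" for k H
    using that unfolding half[symmetric]
    by (intro total_rec_rec_nat[where H = "\<lambda>v. v ! 0 - v ! 1"] total_rec_arith) auto
  have "total_rec k (\<lambda>v. G v div 2 ^ F v)"
    unfolding iter[symmetric]
    by (intro total_rec_rec_nat[where H = "\<lambda>v. v ! 1 div 2"] assms div2 total_rec_arith) auto
  then have "dec k (\<lambda>v. G v div 2 ^ F v - 2 * (G v div 2 ^ F v div 2) = 1)"
    by (intro dec_eq total_rec_arith div2)
  moreover have odd: "odd n \<longleftrightarrow> n - 2 * (n div 2) = 1" for n :: nat by presburger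
  ultimately show ?thesis unfolding set_decode_def mem_Collect_eq odd by simp
qed


subsection \<open>An undecidable recursively enumerable set\<close>

primrec rcode :: "recf \<Rightarrow> nat" where
  "rcode Zero = prod_encode (0, 0)"
| "rcode Succ = prod_encode (1, 0)"
| "rcode (Proj i) = prod_encode (2, i)"
| "rcode (Comp f gs) = prod_encode (3, prod_encode (rcode f, list_encode (map rcode gs)))"
| "rcode (Prec f g) = prod_encode (4, prod_encode (rcode f, rcode g))"
| "rcode (Mu f) = prod_encode (5, rcode f)"

definition fact :: "nat \<Rightarrow> nat \<Rightarrow> nat \<Rightarrow> nat \<Rightarrow> nat" where
  "fact k a b c = prod_encode (k, prod_encode (a, prod_encode (b, c)))"

text \<open>This is \<open>list_encode\<close> of a list with head \<open>x\<close> whose tail has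
  code \<open>l\<close>.\<close>

abbreviation ecodes :: "nat \<Rightarrow> nat \<Rightarrow> nat" where
  "ecodes x l \<equiv> Suc (prod_encode (x, l))"

text \<open>
  A fact of kind 0 is \<open>evals\<close> for a single function, kind 1 is \<open>evals\<close> for a list of functions,
  kind 2 is lookup in a list, and kind 3 says that a function is defined and positive at all
  smaller heads. \<open>justified D f w\<close> holds if \<open>f\<close> follows from facts in \<open>D\<close> by one rule, where
  \<open>w\<close> is a value that occurs only in the premises.
\<close>

definition justified0 :: "nat set \<Rightarrow> nat \<Rightarrow> nat \<Rightarrow> nat \<Rightarrow> nat \<Rightarrow> bool" where
  "justified0 D k a b c \<longleftrightarrow>
     k = 0 \<and> pr1 a = 0 \<and> c = 0 \<or>
     k = 0 \<and> pr1 a = 1 \<and> b = ecodes (c - 1) 0 \<and> \<not> c = 0 \<or>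
     k = 0 \<and> pr1 a = 2 \<and> fact 2 (pr2 a) b c \<in> D \<or>
     k = 0 \<and> pr1 a = 4 \<and> \<not> b = 0 \<and> pr1 (b - 1) = 0 \<and> fact 0 (pr1 (pr2 a)) (pr2 (b - 1)) c \<in> D \<or>
     k = 0 \<and> pr1 a = 5 \<and> fact 0 (pr2 a) (ecodes c b) 0 \<in> D \<and> fact 3 (pr2 a) b c \<in> D \<or>
     k = 1 \<and> a = 0 \<and> c = 0 \<or>
     k = 1 \<and> \<not> a = 0 \<and> \<not> c = 0 \<and> fact 0 (pr1 (a - 1)) b (pr1 (c - 1)) \<in> D \<and>
       fact 1 (pr2 (a - 1)) b (pr2 (c - 1)) \<in> D \<or>
     k = 2 \<and> \<not> b = 0 \<and> a = 0 \<and> c = pr1 (b - 1) \<or>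
     k = 2 \<and> \<not> b = 0 \<and> \<not> a = 0 \<and> fact 2 (a - 1) (pr2 (b - 1)) c \<in> D \<or>
     k = 3 \<and> c = 0"

text \<open>The value \<open>w\<close> is, in turn, the code of the list of inner values of a
  composition, the previous value of a recursion, and the predecessor of a positive value met during
  minimisation.\<close>

definition justified1 :: "nat set \<Rightarrow> nat \<Rightarrow> nat \<Rightarrow> nat \<Rightarrow> nat \<Rightarrow> nat \<Rightarrow> bool" where
  "justified1 D k a b c w \<longleftrightarrow>
     k = 0 \<and> pr1 a = 3 \<and> fact 1 (pr2 (pr2 a)) b w \<in> D \<and> fact 0 (pr1 (pr2 a)) w c \<in> D \<or>
     k = 0 \<and> pr1 a = 4 \<and> \<not> b = 0 \<and> \<not> pr1 (b - 1) = 0 \<and>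
       fact 0 a (ecodes (pr1 (b - 1) - 1) (pr2 (b - 1))) w \<in> D \<and>
       fact 0 (pr2 (pr2 a)) (ecodes (pr1 (b - 1) - 1) (ecodes w (pr2 (b - 1)))) c \<in> D \<or>
     k = 3 \<and> \<not> c = 0 \<and> fact 0 a (ecodes (c - 1) b) (Suc w) \<in> D \<and> fact 3 a b (c - 1) \<in> D"

definition justified :: "nat set \<Rightarrow> nat \<Rightarrow> nat \<Rightarrow> bool" where
  "justified D f w \<longleftrightarrow>
     justified0 D (pr1 f) (pr1 (pr2 f)) (pr1 (pr2 (pr2 f))) (pr2 (pr2 (pr2 f))) \<or>
     justified1 D (pr1 f) (pr1 (pr2 f)) (pr1 (pr2 (pr2 f))) (pr2 (pr2 (pr2 f))) w"

lemma justified_fact: "justified D (fact k a b c) w \<longleftrightarrow> justified0 D k a b c \<or> justified1 D k a b c w"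
  by (simp add: justified_def fact_def)

lemma justified_mono: "justified D f w \<Longrightarrow> D \<subseteq> D' \<Longrightarrow> justified D' f w"
  unfolding justified_def justified0_def justified1_def by (elim disjE) auto

section \<open>Derivations as finite closed sets\<close>

definition backward_closed :: "nat set \<Rightarrow> bool" where
  "backward_closed D \<longleftrightarrow> (\<forall>f \<in> D. \<exists>w. justified D f w)"

text \<open>A finite set replaces a derivation tree, since it can be coded by one number.
  Well-foundedness is not demanded of the set; \<open>evals_sound\<close> obtains it from the shape
  of the rules.\<close>

definition derivable :: "nat \<Rightarrow> bool" where
  "derivable f \<longleftrightarrow> (\<exists>D. finite D \<and> backward_closed D \<and> f \<in> D)"

text \<open>Justification is monotone in the set, so the finite closed sets of the premises can be
  merged. The rules of \<open>justified\<close> thereby become introduction rules for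
  \<open>derivable\<close>.\<close>

lemma derivableI:
  assumes "finite P" and "\<And>g. g \<in> P \<Longrightarrow> derivable g" and "justified P f w"
  shows "derivable f"
proof -
  obtain E where E: "\<And>g. g \<in> P \<Longrightarrow> finite (E g) \<and> backward_closed (E g) \<and> g \<in> E g"
    using assms(2) unfolding derivable_def by metis
  define D where "D = insert f (\<Union>g \<in> P. E g)"
  have "P \<subseteq> D" using E by (auto simp: D_def)
  then have "justified D f w" using assms(3) by (rule justified_mono[rotated])
  moreover have "\<exists>w. justified D h w" if "g \<in> P" "h \<in> E g" for g h
  proof -
    from E[OF that(1)] that(2) obtain w where "justified (E g) h w"
      unfolding backward_closed_def by blast
    moreover have "E g \<subseteq> D" using that by (auto simp: D_def)
    ultimately show ?thesis using justified_mono by blast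
  qed
  ultimately have "backward_closed D" by (auto simp: backward_closed_def D_def)
  then show ?thesis
    unfolding derivable_def using E assms(1) by (intro exI[of _ D]) (auto simp: D_def)
qed

lemma derivable_nth: "i < length xs \<Longrightarrow> derivable (fact 2 i (list_encode xs) (xs ! i))"
proof (induction xs arbitrary: i)
  case (Cons x xs)
  show ?case
  proof (cases i)
    case 0
    then show ?thesis
      by - (rule derivableI[of "{}" _ 0], auto simp: justified_fact justified0_def)
  next
    case (Suc j)
    with Cons show ?thesis
      by - (rule derivableI[of "{fact 2 j (list_encode xs) (xs ! j)}" _ 0],
        auto simp: justified_fact justified0_def)
  qed
qed simp

lemma derivable_list:
  "list_all2 (\<lambda>g y. derivable (fact 0 (rcode g) b y)) gs ys \<Longrightarrow>
    derivable (fact 1 (list_encode (map rcode gs)) b (list_encode ys))"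
proof (induction gs ys rule: list_all2_induct)
  case Nil
  show ?case by - (rule derivableI[of "{}" _ 0], auto simp: justified_fact justified0_def)
next
  case (Cons g gs y ys)
  then show ?case
    by - (rule derivableI[of "{fact 0 (rcode g) b y, fact 1 (list_encode (map rcode gs)) b (list_encode ys)}" _ 0],
      auto simp: justified_fact justified0_def)
qed

lemma derivable_positive:
  assumes "\<And>m. m < n \<Longrightarrow> \<exists>y>0. derivable (fact 0 (rcode f) (ecodes m b) y)"
  shows "derivable (fact 3 (rcode f) b n)"
  using assms
proof (induction n)
  case 0
  show ?case by - (rule derivableI[of "{}" _ 0], auto simp: justified_fact justified0_def)
next
  case (Suc n)
  obtain y where "derivable (fact 0 (rcode f) (ecodes n b) (Suc y))"
    using Suc.prems[of n] by (metis gr0_implies_Suc lessI)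
  then show ?case
    using Suc
    by - (rule derivableI[of "{fact 0 (rcode f) (ecodes n b) (Suc y), fact 3 (rcode f) b n}" _ y],
      auto simp: justified_fact justified1_def)
qed

text \<open>Each evaluation rule has a counterpart in \<open>justified\<close>. The set given to
  \<open>derivableI\<close> lists its premises, and the last argument is the intermediate value, or
  0 if the rule has none.\<close>

lemma evals_derivable: "evals r xs y \<Longrightarrow> derivable (fact 0 (rcode r) (list_encode xs) y)"
proof (induction rule: evals.induct)
  case (1 xs)
  show ?case by - (rule derivableI[of "{}" _ 0], auto simp: justified_fact justified0_def)
next
  case (2 x)
  show ?case by - (rule derivableI[of "{}" _ 0], auto simp: justified_fact justified0_def)
next
  case (3 i xs)
  then show ?case
    by - (rule derivableI[of "{fact 2 i (list_encode xs) (xs ! i)}" _ 0],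
      auto simp: justified_fact justified0_def derivable_nth)
next
  case (4 xs gs ys f z)
  have "derivable (fact 1 (list_encode (map rcode gs)) (list_encode xs) (list_encode ys))"
    by (rule derivable_list, rule list.rel_mono_strong[OF 4(1)]) auto
  with 4(2,3) show ?case
    by - (rule derivableI[of "{fact 1 (list_encode (map rcode gs)) (list_encode xs) (list_encode ys),
          fact 0 (rcode f) (list_encode ys) z}" _ "list_encode ys"],
      auto simp: justified_fact justified1_def)
next
  case (5 f xs y g)
  then show ?case
    by - (rule derivableI[of "{fact 0 (rcode f) (list_encode xs) y}" _ 0],
      auto simp: justified_fact justified0_def)
next
  case (6 f g n xs y z)
  then show ?case
    by - (rule derivableI[of "{fact 0 (rcode (Prec f g)) (list_encode (n # xs)) y,
          fact 0 (rcode g) (list_encode (n # y # xs)) z}" _ y],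
      auto simp: justified_fact justified1_def)
next
  case (7 f n xs)
  have "derivable (fact 3 (rcode f) (list_encode xs) n)"
    by (rule derivable_positive) (use 7 in auto)
  with 7 show ?case
    by - (rule derivableI[of "{fact 0 (rcode f) (list_encode (n # xs)) 0,
          fact 3 (rcode f) (list_encode xs) n}" _ 0],
      auto simp: justified_fact justified0_def)
qed

lemma backward_closedD: "backward_closed D \<Longrightarrow> fact k a b c \<in> D \<Longrightarrow> justified0 D k a b c \<or> (\<exists>w. justified1 D k a b c w)"
  unfolding backward_closed_def by (metis justified_fact)

section \<open>Soundness of closed sets\<close>

context
  fixes D :: "nat set"
  assumes closed: "backward_closed D"
begin

lemma lookup_sound: "fact 2 i (list_encode xs) y \<in> D \<Longrightarrow> i < length xs \<and> y = xs ! i"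
proof (induction xs arbitrary: i)
  case Nil
  then show ?case using backward_closedD[OF closed, of 2 i 0 y] by (auto simp: justified0_def justified1_def)
next
  case (Cons x xs)
  then show ?case using backward_closedD[OF closed, of 2 i "list_encode (x # xs)" y]
    by (cases i) (auto simp: justified0_def justified1_def)
qed

lemma list_sound:
  assumes "\<And>g b y. g \<in> set gs \<Longrightarrow> fact 0 (rcode g) b y \<in> D \<Longrightarrow> evals g (list_decode b) y"
    and "fact 1 (list_encode (map rcode gs)) b c \<in> D"
  shows "list_all2 (\<lambda>g y. evals g (list_decode b) y) gs (list_decode c)"
  using assms
proof (induction gs arbitrary: c)
  case Nil
  then show ?case using backward_closedD[OF closed, of 1 0 b c] by (auto simp: justified0_def justified1_def)
next
  case (Cons g gs)
  obtain c' where c': "c = Suc c'" "fact 0 (rcode g) b (pr1 c') \<in> D"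
    "fact 1 (list_encode (map rcode gs)) b (pr2 c') \<in> D"
    using backward_closedD[OF closed Cons(3)]
    by (cases c) (auto simp: justified0_def justified1_def)
  then have "list_decode c = pr1 c' # list_decode (pr2 c')"
    by (simp add: pr1_def pr2_def case_prod_beta)
  then show ?case using Cons c' by auto
qed

lemma positive_sound:
  assumes "\<And>b y. fact 0 (rcode f) b y \<in> D \<Longrightarrow> evals f (list_decode b) y"
  shows "fact 3 (rcode f) (list_encode xs) n \<in> D \<Longrightarrow> m < n \<Longrightarrow> \<exists>y>0. evals f (m # xs) y"
proof (induction n)
  case (Suc n)
  obtain w where w: "fact 0 (rcode f) (ecodes n (list_encode xs)) (Suc w) \<in> D"
    "fact 3 (rcode f) (list_encode xs) n \<in> D"
    using backward_closedD[OF closed Suc(2)] by (auto simp: justified0_def justified1_def)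
  have "evals f (n # xs) (Suc w)" using assms[OF w(1)] by simp
  then show ?case using Suc w(2) by (cases "m = n") auto
qed simp

text \<open>Induction on \<open>r\<close>, with an inner induction on the recursion argument for
  \<open>Prec\<close>. Premises always concern a smaller function or a smaller recursion argument,
  so no false evaluation can support itself in \<open>D\<close>.\<close>

lemma evals_sound: "fact 0 (rcode r) b y \<in> D \<Longrightarrow> evals r (list_decode b) y"
proof (induction r arbitrary: b y)
  case Zero
  then show ?case
    using backward_closedD[OF closed Zero] by (auto simp: justified0_def justified1_def intro: evals.intros)
next
  case Succ
  then show ?case
    using backward_closedD[OF closed Succ] evals.intros(2)[of "y - 1"]
    by (auto simp: justified0_def justified1_def)
next
  case (Proj i)
  have "fact 2 i (list_encode (list_decode b)) y \<in> D"
    using backward_closedD[OF closed Proj] by (auto simp: justified0_def justified1_def)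
  then show ?case using lookup_sound evals.intros(3) by blast
next
  case (Comp f gs)
  obtain w where "fact 1 (list_encode (map rcode gs)) b w \<in> D" "fact 0 (rcode f) w y \<in> D"
    using backward_closedD[OF closed Comp(3)] by (auto simp: justified0_def justified1_def)
  then show ?case using list_sound[of gs b w] Comp(1,2) evals.intros(4) by blast
next
  case (Prec f g)
  have "fact 0 (rcode (Prec f g)) (list_encode (n # xs)) y \<in> D \<Longrightarrow> evals (Prec f g) (n # xs) y" for n xs y
  proof (induction n arbitrary: y)
    case 0
    have "fact 0 (rcode f) (list_encode xs) y \<in> D"
      using backward_closedD[OF closed 0] by (auto simp: justified0_def justified1_def)
    then show ?case using Prec(1) by (fastforce intro: evals.intros)
  next
    case (Suc n)
    obtain w where w: "fact 0 (rcode (Prec f g)) (list_encode (n # xs)) w \<in> D"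
      "fact 0 (rcode g) (list_encode (n # w # xs)) y \<in> D"
      using backward_closedD[OF closed Suc(2)] by (auto simp: justified0_def justified1_def)
    then show ?case using Prec(2)[OF w(2)] Suc(1)[OF w(1)] by (auto intro: evals.intros)
  qed
  \<comment> \<open>Every rule for \<open>Prec\<close> requires a nonzero code, that is, a nonempty
    argument list.\<close>
  moreover have "list_decode b \<noteq> []"
    using backward_closedD[OF closed Prec(3)] by (cases b) (auto simp: justified0_def justified1_def case_prod_beta)
  then obtain n xs where "b = list_encode (n # xs)"
    by (metis list.exhaust list_decode_inverse)
  ultimately show ?case using Prec(3) by simp
next
  case (Mu f)
  have "fact 0 (rcode f) (ecodes y b) 0 \<in> D" "fact 3 (rcode f) (list_encode (list_decode b)) y \<in> D"
    using backward_closedD[OF closed Mu(2)] by (auto simp: justified0_def justified1_def)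
  then show ?case
    using Mu(1)[of "ecodes y b" 0] positive_sound[OF Mu(1)] by (intro evals.intros(7)) auto
qed

end

theorem derivable_iff_evals: "derivable (fact 0 (rcode r) (list_encode xs) y) \<longleftrightarrow> evals r xs y"
  using evals_derivable evals_sound by (metis derivable_def list_encode_inverse)

section \<open>Deciding closedness by bounded search\<close>

lemma set_decode_less: "x \<in> set_decode n \<Longrightarrow> x < n"
proof -
  assume "x \<in> set_decode n"
  then have "n div 2 ^ x \<noteq> 0" by (metis even_zero mem_Collect_eq set_decode_def)
  then have "2 ^ x \<le> n" by (simp add: div_eq_0_iff)
  then show ?thesis using less_exp[of x] by linarith
qed

lemma fact_ge: "a \<le> fact k a b c" "b \<le> fact k a b c" "c \<le> fact k a b c"
  unfolding fact_def
  by (meson le_prod_encode_1 le_prod_encode_2 order_trans)+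

text \<open>A value \<open>w\<close> used by a rule occurs inside a premise in the set, and all
  elements of \<open>set_decode d\<close> are below \<open>d\<close>. Hence the quantifier over
  \<open>w\<close> can be bounded. If no such value is used, 0 serves.\<close>

lemma justified_witness:
  assumes "justified (set_decode d) f w" and "f \<in> set_decode d"
  shows "\<exists>w<d. justified (set_decode d) f w"
proof (cases "justified0 (set_decode d) (pr1 f) (pr1 (pr2 f)) (pr1 (pr2 (pr2 f))) (pr2 (pr2 (pr2 f)))")
  case True
  then show ?thesis
    using set_decode_less[OF assms(2)] by (intro exI[of _ 0]) (auto simp: justified_def)
next
  case False
  have "w < d" if "fact k a b c \<in> set_decode d" "w \<le> a \<or> w \<le> b \<or> w \<le> c" for k a b c
    using set_decode_less[OF that(1)] that(2) fact_ge[where k = k and a = a and b = b and c = c] by linarith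
  with False assms(1) show ?thesis
    unfolding justified_def justified1_def by (metis le_SucI order_refl)
qed

lemma dec_justified:
  assumes "total_rec k D" "total_rec k F" "total_rec k W"
  shows "dec k (\<lambda>v. justified (set_decode (D v)) (F v) (W v))"
  unfolding justified_def justified0_def justified1_def fact_def
  by (intro dec_disj dec_conj dec_not dec_eq dec_set_decode total_rec_const total_rec_pr
      total_rec_prod_encode total_rec_arith assms)

lemma dec_backward_closed:
  assumes "total_rec k D"
  shows "dec k (\<lambda>v. backward_closed (set_decode (D v)))"
proof -
  have eq: "backward_closed (set_decode d) \<longleftrightarrow>
      \<not> (\<exists>f<d. f \<in> set_decode d \<and> \<not> (\<exists>w<d. justified (set_decode d) f w))" for d
    unfolding backward_closed_def using set_decode_less justified_witness by blast
  have "dec 2 (\<lambda>v. \<exists>w<v ! 1. justified (set_decode (v ! 1)) (v ! 0) w)"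
    by (rule dec_bex[where Q = "\<lambda>v. justified (set_decode (v ! 2)) (v ! 1) (v ! 0)"])
      (auto simp: numeral_2_eq_2 intro!: dec_justified total_rec_nth)
  then have "dec 2 (\<lambda>v. v ! 0 \<in> set_decode (v ! 1) \<and> \<not> (\<exists>w<v ! 1. justified (set_decode (v ! 1)) (v ! 0) w))"
    by (intro dec_conj dec_not dec_set_decode total_rec_nth) auto
  then have "dec 1 (\<lambda>v. \<exists>f<v ! 0. f \<in> set_decode (v ! 0) \<and> \<not> (\<exists>w<v ! 0. justified (set_decode (v ! 0)) f w))"
    by (intro dec_bex[where Q = "\<lambda>v. v ! 0 \<in> set_decode (v ! 1) \<and> \<not> (\<exists>w<v ! 1. justified (set_decode (v ! 1)) (v ! 0) w)"])
      (auto simp: numeral_2_eq_2 intro!: total_rec_nth)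
  then have "dec 1 (\<lambda>v. backward_closed (set_decode (v ! 0)))"
    unfolding eq by (rule dec_not)
  from total_rec_comp1[where f = "\<lambda>d. of_bool (backward_closed (set_decode d))", OF this assms]
  show ?thesis .
qed

text \<open>Diagonal argument with the functions that are defined at their own code.\<close>

theorem ex_recursively_enumerable_not_decidable:
  "\<exists>A. recursively_enumerable A \<and> \<not> decidable (- A)"
proof -
  \<comment> \<open>\<open>m\<close> pairs the code of a finite closed set with the claimed value;
    \<open>ecodes n 0\<close> codes the list with the single entry \<open>n\<close>.\<close>
  define P where "P = (\<lambda>m n. backward_closed (set_decode (pr1 m)) \<and>
    fact 0 n (ecodes n 0) (pr2 m) \<in> set_decode (pr1 m))"
  define K where "K = {n. \<exists>m. P m n}"
  have "dec 2 (\<lambda>v. P (v ! 0) (v ! 1))"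
    unfolding P_def fact_def
    by (intro dec_conj dec_backward_closed dec_set_decode total_rec_pr total_rec_prod_encode
        total_rec_arith) auto
  then have re: "recursively_enumerable K" unfolding K_def by (rule recursively_enumerable_ex)
  have K: "rcode r \<in> K \<longleftrightarrow> (\<exists>y. evals r [rcode r] y)" for r
  proof -
    have "rcode r \<in> K \<longleftrightarrow> (\<exists>y. derivable (fact 0 (rcode r) (list_encode [rcode r]) y))"
    proof
      assume "rcode r \<in> K"
      then show "\<exists>y. derivable (fact 0 (rcode r) (list_encode [rcode r]) y)"
        unfolding K_def P_def derivable_def by (auto intro: finite_set_decode)
    next
      assume "\<exists>y. derivable (fact 0 (rcode r) (list_encode [rcode r]) y)"
      then obtain y D where D: "finite D" "backward_closed D" "fact 0 (rcode r) (list_encode [rcode r]) y \<in> D"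
        by (auto simp: derivable_def)
      then have "P (prod_encode (set_encode D, y)) (rcode r)" by (simp add: P_def)
      then show "rcode r \<in> K" unfolding K_def by blast
    qed
    then show ?thesis by (simp only: derivable_iff_evals)
  qed
  have "\<not> decidable (- K)"
  proof
    assume "decidable (- K)"
    then have "dec 1 (\<lambda>v. v ! 0 \<notin> K)"
      using computable_imp_total_rec by (fastforce simp: decidable_def of_bool_def)
    then have "total_rec 2 (\<lambda>v. of_bool (v ! 1 \<notin> K))"
      by (rule total_rec_comp1[where f = "\<lambda>n. of_bool (n \<notin> K)"]) (simp add: total_rec_nth)
    \<comment> \<open>A dummy search variable makes the decidable complement the domain of some
      function \<open>r\<close>. At its own code \<open>r\<close> is then defined iff it is
      undefined.\<close>
    then have "recursively_enumerable {n. \<exists>m::nat. n \<notin> K}"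
      by (intro recursively_enumerable_ex) simp
    then obtain r where "n \<notin> K \<longleftrightarrow> (\<exists>y. evals r [n] y)" for n
      by (auto simp: recursively_enumerable_def)
    with K[of r] show False by blast
  qed
  with re show ?thesis by blast
qed

lemma co_RE_hard_not_decidable:
  assumes "co_RE_hard B"
  shows "\<not> decidable B"
proof
  assume "decidable B"
  obtain A where A: "recursively_enumerable A" "\<not> decidable (- A)"
    using ex_recursively_enumerable_not_decidable by blast
  then obtain f where f: "computable f" "\<And>n. n \<in> - A \<longleftrightarrow> f n \<in> B"
    using assms unfolding co_RE_hard_def many_one_reducible_def by (metis double_complement)
  have "total_rec 1 (\<lambda>v. (if f (v ! 0) \<in> B then 1 else 0))"
    by (rule total_rec_comp1[where f = "\<lambda>n. if n \<in> B then 1 else 0",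
          OF computable_imp_total_rec[OF \<open>decidable B\<close>[unfolded decidable_def]]
            computable_imp_total_rec[OF f(1)]])
  then have "total_rec 1 (\<lambda>v. (if v ! 0 \<in> - A then 1 else 0))" by (simp only: f(2))
  then have "decidable (- A)" unfolding decidable_def by (rule total_rec_imp_computable)
  with A(2) show False ..
qed

section \<open>While programs\<close>

datatype rhs = Nought | Copy nat | Incr nat | Decr nat

datatype cmd = Assign nat rhs | Seq cmd cmd | While nat cmd

fun rhs_val :: "(nat \<Rightarrow> nat) \<Rightarrow> rhs \<Rightarrow> nat" where
  "rhs_val s Nought = 0"
| "rhs_val s (Copy j) = s j"
| "rhs_val s (Incr j) = Suc (s j)"
| "rhs_val s (Decr j) = s j - 1"

inductive exec :: "cmd \<Rightarrow> (nat \<Rightarrow> nat) \<Rightarrow> (nat \<Rightarrow> nat) \<Rightarrow> bool" where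
  exec_Assign: "exec (Assign i e) s (s(i := rhs_val s e))"
| exec_Seq: "exec a s s' \<Longrightarrow> exec b s' t \<Longrightarrow> exec (Seq a b) s t"
| exec_While_False: "s i = 0 \<Longrightarrow> exec (While i a) s s"
| exec_While_True: "s i \<noteq> 0 \<Longrightarrow> exec a s s' \<Longrightarrow> exec (While i a) s' t \<Longrightarrow> exec (While i a) s t"

inductive_cases exec_AssignE: "exec (Assign i e) s t"
inductive_cases exec_SeqE: "exec (Seq a b) s t"

lemma exec_Assign_iff: "exec (Assign i e) s t \<longleftrightarrow> t = s(i := rhs_val s e)"
  by (auto elim: exec_AssignE intro: exec_Assign)

lemma exec_Seq_iff: "exec (Seq a b) s t \<longleftrightarrow> (\<exists>s'. exec a s s' \<and> exec b s' t)"
  by (auto elim: exec_SeqE intro: exec_Seq)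

lemma exec_While_inv:
  assumes "exec (While i a) s t" and "I s"
    and "\<And>s s'. I s \<Longrightarrow> s i \<noteq> 0 \<Longrightarrow> exec a s s' \<Longrightarrow> I s'"
  shows "I t \<and> t i = 0"
  using assms(1,2)
  by (induction "While i a" s t rule: exec.induct) (auto intro: assms(3))

text \<open>
  \<open>compile f as b\<close> reads its arguments from the registers \<open>as\<close>, all below \<open>b\<close>, returns the result
  in register \<open>b\<close> and uses the registers above \<open>b\<close> as scratch space.
\<close>

primrec compile_list :: "(nat list \<Rightarrow> nat \<Rightarrow> cmd) list \<Rightarrow> nat list \<Rightarrow> nat \<Rightarrow> cmd" where
  "compile_list [] as b = Assign b Nought"
| "compile_list (c # cs) as b = Seq (c as b) (compile_list cs as (Suc b))"

definition diverge :: "nat \<Rightarrow> cmd" where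
  "diverge b = Seq (Assign b (Incr b)) (While b (Assign b (Copy b)))"

text \<open>Arities at which \<open>evals\<close> has no value lead to divergence. For
  \<open>Prec\<close>, register \<open>b\<close> holds the current value, \<open>b + 1\<close> the
  counter and \<open>b + 2\<close> the number of rounds left. For \<open>Mu\<close>, register
  \<open>b\<close> holds the candidate and \<open>b + 1\<close> its value.\<close>

primrec compile :: "recf \<Rightarrow> nat list \<Rightarrow> nat \<Rightarrow> cmd" where
  "compile Zero = (\<lambda>as b. Assign b Nought)"
| "compile Succ = (\<lambda>as b. if length as = 1 then Assign b (Incr (as ! 0)) else diverge b)"
| "compile (Proj i) = (\<lambda>as b. if i < length as then Assign b (Copy (as ! i)) else diverge b)"
| "compile (Comp f gs) = (\<lambda>as b. let m = length gs in
     Seq (compile_list (map compile gs) as (Suc b))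
       (Seq (compile f [Suc b..<Suc b + m] (Suc b + m)) (Assign b (Copy (Suc b + m)))))"
| "compile (Prec f g) = (\<lambda>as b. if as = [] then diverge b else
     Seq (Assign (b + 1) Nought) (Seq (Assign (b + 2) (Copy (hd as)))
       (Seq (compile f (tl as) (b + 3)) (Seq (Assign b (Copy (b + 3)))
         (While (b + 2) (Seq (compile g ((b + 1) # b # tl as) (b + 3)) (Seq (Assign b (Copy (b + 3)))
           (Seq (Assign (b + 1) (Incr (b + 1))) (Assign (b + 2) (Decr (b + 2)))))))))))"
| "compile (Mu f) = (\<lambda>as b.
     Seq (Assign b Nought) (Seq (compile f (b # as) (b + 1))
       (While (b + 1) (Seq (Assign b (Incr b)) (compile f (b # as) (b + 1))))))"

lemma not_exec_diverge: "\<not> exec (diverge b) s t"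
proof
  assume "exec (diverge b) s t"
  then obtain s' where "exec (While b (Assign b (Copy b))) s' t" "s' b > 0"
    by (auto simp: diverge_def exec_Seq_iff exec_Assign_iff)
  then have "0 < t b \<and> t b = 0"
    by (rule exec_While_inv[where I = "\<lambda>u. 0 < u b"]) (auto simp: exec_Assign_iff)
  then show False by auto
qed

section \<open>Soundness of compilation\<close>

definition agree :: "nat \<Rightarrow> (nat \<Rightarrow> nat) \<Rightarrow> (nat \<Rightarrow> nat) \<Rightarrow> bool" where
  "agree b s t \<longleftrightarrow> (\<forall>i<b. t i = s i)"

lemma agree_trans: "agree b s t \<Longrightarrow> agree c t u \<Longrightarrow> b \<le> c \<Longrightarrow> agree b s u"
  by (auto simp: agree_def)

lemma agree_map: "agree b s t \<Longrightarrow> set as \<subseteq> {..<b} \<Longrightarrow> map t as = map s as"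
  by (auto simp: agree_def)

lemma compile_list_sound:
  assumes "\<And>g as b s t. g \<in> set gs \<Longrightarrow> exec (compile g as b) s t \<Longrightarrow> set as \<subseteq> {..<b} \<Longrightarrow>
      evals g (map s as) (t b) \<and> agree b s t"
    and "exec (compile_list (map compile gs) as b) s t" and "set as \<subseteq> {..<b}"
  shows "list_all2 (\<lambda>g y. evals g (map s as) y) gs (map t [b..<b + length gs]) \<and> agree b s t"
  using assms
proof (induction gs arbitrary: b s)
  case Nil
  then show ?case by (auto simp: exec_Assign_iff agree_def)
next
  case (Cons g gs)
  obtain s' where s': "exec (compile g as b) s s'" "exec (compile_list (map compile gs) as (Suc b)) s' t"
    using Cons.prems(2) by (auto simp: exec_Seq_iff)
  have g: "evals g (map s as) (s' b)" "agree b s s'"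
    using Cons.prems(1)[OF _ s'(1)] Cons.prems(3) by auto
  have "list_all2 (\<lambda>g y. evals g (map s' as) y) gs (map t [Suc b..<Suc b + length gs]) \<and> agree (Suc b) s' t"
  proof (rule Cons.IH[OF _ s'(2)])
    show "evals h (map s as) (t b) \<and> agree b s t"
      if "h \<in> set gs" "exec (compile h as b) s t" "set as \<subseteq> {..<b}" for h as b s t
      using that by (intro Cons.prems(1)) auto
  qed (use Cons.prems(3) in auto)
  moreover have "map s' as = map s as" using g(2) Cons.prems(3) by (rule agree_map)
  ultimately show ?case
    using g agree_trans[of b s s' "Suc b" t]
    by (auto simp: upt_conv_Cons agree_def simp del: upt_Suc)
qed

text \<open>The frame condition \<open>agree b\<close> is proved along with the result: it keeps
  arguments, counters and earlier results intact while a subprogram runs in higher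
  registers.\<close>

lemma compile_sound:
  "exec (compile f as b) s t \<Longrightarrow> set as \<subseteq> {..<b} \<Longrightarrow> evals f (map s as) (t b) \<and> agree b s t"
proof (induction f arbitrary: as b s t)
  case Zero
  then show ?case by (auto simp: exec_Assign_iff agree_def intro: evals.intros)
next
  case Succ
  then show ?case using evals.intros(2)[of "s (as ! 0)"]
    by (auto simp: exec_Assign_iff agree_def not_exec_diverge length_Suc_conv split: if_splits)
next
  case (Proj i)
  then show ?case using evals.intros(3)[of i "map s as"]
    by (auto simp: exec_Assign_iff agree_def not_exec_diverge split: if_splits)
next
  case (Comp f gs)
  let ?m = "length gs"
  obtain s1 s2 where s: "exec (compile_list (map compile gs) as (Suc b)) s s1"
    "exec (compile f [Suc b..<Suc b + ?m] (Suc b + ?m)) s1 s2" "t = s2(b := s2 (Suc b + ?m))"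
    using Comp.prems(1) by (auto simp: exec_Seq_iff exec_Assign_iff Let_def simp del: upt_Suc)
  have 1: "list_all2 (\<lambda>g y. evals g (map s as) y) gs (map s1 [Suc b..<Suc b + ?m]) \<and> agree (Suc b) s s1"
    by (rule compile_list_sound[OF Comp.IH(2) s(1)]) (use Comp.prems(2) in auto)
  have 2: "evals f (map s1 [Suc b..<Suc b + ?m]) (s2 (Suc b + ?m)) \<and> agree (Suc b + ?m) s1 s2"
    by (rule Comp.IH(1)[OF s(2)]) auto
  show ?case using 1 2 s(3) evals.intros(4)[of "map s as" gs] by (auto simp: agree_def)
next
  case (Prec f g)
  then have "as \<noteq> []" by (auto simp: not_exec_diverge)
  then obtain a as' where as: "as = a # as'" by (cases as) auto
  let ?body = "Seq (compile g ((b + 1) # b # as') (b + 3)) (Seq (Assign b (Copy (b + 3)))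
           (Seq (Assign (b + 1) (Incr (b + 1))) (Assign (b + 2) (Decr (b + 2)))))"
  let ?s1 = "s(b + 1 := 0, b + 2 := s a)"
  have "a < b" using Prec.prems(2) by (simp add: as)
  then have "\<exists>s2. exec (compile f as' (b + 3)) ?s1 s2 \<and> exec (While (b + 2) ?body) (s2(b := s2 (b + 3))) t"
    using Prec.prems(1) by (simp add: as exec_Seq_iff exec_Assign_iff)
  then obtain s2 where s: "exec (compile f as' (b + 3)) ?s1 s2"
    "exec (While (b + 2) ?body) (s2(b := s2 (b + 3))) t"
    by blast
  have "evals f (map ?s1 as') (s2 (b + 3)) \<and> agree (b + 3) ?s1 s2"
    by (rule Prec.IH(1)[OF s(1)]) (use Prec.prems(2) in \<open>auto simp: as\<close>)
  then have f: "evals f (map ?s1 as') (s2 (b + 3))" "agree (b + 3) ?s1 s2" by blast+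
  \<comment> \<open>Counter plus remaining rounds is constantly the recursion argument, so when the
    loop ends, the counter equals that argument and \<open>b\<close> holds its value.\<close>
  define I where "I = (\<lambda>u. agree b s u \<and> u (b + 1) + u (b + 2) = s a \<and>
    evals (Prec f g) (u (b + 1) # map s as') (u b))"
  have "map ?s1 as' = map s as'" using Prec.prems(2) by (auto simp: as)
  with f(1) have "evals f (map s as') (s2 (b + 3))" by (simp only:)
  then have "evals (Prec f g) (0 # map s as') (s2 (b + 3))" by (rule evals.intros(5))
  with f(2) have "I (s2(b := s2 (b + 3)))" by (auto simp: I_def agree_def)
  with s(2) have "I t \<and> t (b + 2) = 0"
  proof (rule exec_While_inv[where I = I])
    fix u u'
    assume u: "I u" "u (b + 2) \<noteq> 0" "exec ?body u u'"
    then have "\<exists>v. exec (compile g ((b + 1) # b # as') (b + 3)) u v \<and>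
      u' = v(b := v (b + 3), b + 1 := Suc (v (b + 1)), b + 2 := v (b + 2) - 1)"
      by (simp add: exec_Seq_iff exec_Assign_iff)
    then obtain v where v: "exec (compile g ((b + 1) # b # as') (b + 3)) u v"
      "u' = v(b := v (b + 3), b + 1 := Suc (v (b + 1)), b + 2 := v (b + 2) - 1)"
      by blast
    have g: "evals g (map u ((b + 1) # b # as')) (v (b + 3)) \<and> agree (b + 3) u v"
      by (rule Prec.IH(2)[OF v(1)]) (use Prec.prems(2) in \<open>auto simp: as\<close>)
    have "map u as' = map s as'"
      using u(1) Prec.prems(2) by (intro agree_map[of b]) (auto simp: I_def as)
    with u g show "I u'"
      by (auto simp: I_def v(2) agree_def intro!: evals.intros(6)[of f g _ _ "u b"])
  qed
  then show ?case by (auto simp: I_def as)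
next
  case (Mu f)
  let ?run = "compile f (b # as) (b + 1)"
  have "\<exists>s1. exec ?run (s(b := 0)) s1 \<and> exec (While (b + 1) (Seq (Assign b (Incr b)) ?run)) s1 t"
    using Mu.prems(1) by (simp add: exec_Seq_iff exec_Assign_iff)
  then obtain s1 where s: "exec ?run (s(b := 0)) s1" "exec (While (b + 1) (Seq (Assign b (Incr b)) ?run)) s1 t"
    by blast
  \<comment> \<open>\<open>b + 1\<close> holds the value at the candidate \<open>b\<close>, and all
    smaller candidates have positive values; with value 0 at exit this is the premise of the rule
    for \<open>Mu\<close>.\<close>
  define I where "I = (\<lambda>u. agree b s u \<and> evals f (u b # map s as) (u (b + 1)) \<and>
    (\<forall>m<u b. \<exists>y>0. evals f (m # map s as) y))"
  have run: "evals f (u b # map s as) (v (b + 1)) \<and> agree b s v \<and> v b = u b"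
    if "exec ?run u v" "agree b s u" for u v
  proof -
    have "evals f (map u (b # as)) (v (b + 1)) \<and> agree (b + 1) u v"
      by (rule Mu.IH[OF that(1)]) (use Mu.prems(2) in auto)
    moreover have "map u as = map s as" using that(2) Mu.prems(2) by (rule agree_map)
    ultimately show ?thesis using that(2) by (auto simp: agree_def)
  qed
  have "I s1" using run[OF s(1)] by (auto simp: I_def agree_def)
  with s(2) have "I t \<and> t (b + 1) = 0"
  proof (rule exec_While_inv[where I = I])
    fix u u'
    assume u: "I u" "u (b + 1) \<noteq> 0" "exec (Seq (Assign b (Incr b)) ?run) u u'"
    then have "exec ?run (u(b := Suc (u b))) u'"
      by (auto simp: exec_Seq_iff exec_Assign_iff)
    moreover have "agree b s (u(b := Suc (u b)))" using u(1) by (auto simp: I_def agree_def)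
    ultimately show "I u'" using run[of "u(b := Suc (u b))" u'] u(1,2)
      by (auto simp: I_def less_Suc_eq)
  qed
  then show ?case by (auto simp: I_def intro: evals.intros(7))
qed

section \<open>Termination of compiled programs\<close>

lemma compile_list_complete:
  assumes "\<And>g as b s y. g \<in> set gs \<Longrightarrow> evals g (map s as) y \<Longrightarrow> set as \<subseteq> {..<b} \<Longrightarrow>
      \<exists>t. exec (compile g as b) s t"
    and "list_all2 (\<lambda>g y. evals g (map s as) y) gs ys" and "set as \<subseteq> {..<b}"
  shows "\<exists>t. exec (compile_list (map compile gs) as b) s t"
  using assms
proof (induction gs arbitrary: ys b s)
  case Nil
  show ?case using exec_Assign by fastforce
next
  case (Cons g gs)
  obtain y ys' where ys: "evals g (map s as) y" "list_all2 (\<lambda>g y. evals g (map s as) y) gs ys'"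
    using Cons.prems(2) by (auto simp: list_all2_Cons1)
  obtain s' where s': "exec (compile g as b) s s'" using Cons.prems(1)[OF _ ys(1) Cons.prems(3)] by auto
  have "agree b s s'" using compile_sound[OF s'] Cons.prems(3) by blast
  then have "map s' as = map s as" using Cons.prems(3) by (rule agree_map)
  then have "list_all2 (\<lambda>g y. evals g (map s' as) y) gs ys'" using ys(2) by (simp only:)
  then have "\<exists>t. exec (compile_list (map compile gs) as (Suc b)) s' t"
    by (rule Cons.IH[rotated]) (use Cons.prems(1,3) in \<open>auto simp: subset_iff less_Suc_eq\<close>)
  then show ?case using s' by (auto intro: exec_Seq)
qed

lemma exec_While_terminates:
  assumes "I s" and "\<And>s. I s \<Longrightarrow> s i \<noteq> 0 \<Longrightarrow> \<exists>s'. exec a s s' \<and> I s' \<and> (m s' :: nat) < m s"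
  shows "\<exists>t. exec (While i a) s t"
  using assms(1)
proof (induction "m s" arbitrary: s rule: less_induct)
  case less
  show ?case
  proof (cases "s i = 0")
    case True
    then show ?thesis using exec_While_False by blast
  next
    case False
    then obtain s' where s': "exec a s s'" "I s'" "m s' < m s" using assms(2) less(2) by blast
    then show ?thesis using less(1) exec_While_True False by blast
  qed
qed

text \<open>An evaluation by recursion passes through all smaller recursion arguments. This ensures
  that every round of the compiled loop terminates.\<close>

lemma evals_Prec_le:
  "evals (Prec f g) (n # xs) y \<Longrightarrow> m \<le> n \<Longrightarrow> \<exists>z. evals (Prec f g) (m # xs) z"
proof (induction n arbitrary: y)
  case (Suc n)
  then obtain y' where "evals (Prec f g) (n # xs) y'" by (auto elim: evals_PrecE)
  with Suc show ?case by (cases "m = Suc n") auto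
qed auto

lemma compile_complete:
  "evals f (map s as) y \<Longrightarrow> set as \<subseteq> {..<b} \<Longrightarrow> \<exists>t. exec (compile f as b) s t"
proof (induction f arbitrary: s as b y)
  case Zero
  show ?case using exec_Assign by fastforce
next
  case Succ
  then have "length as = 1" by (auto elim: evals_SuccE)
  then show ?case using exec_Assign by fastforce
next
  case (Proj i)
  then have "i < length as" by (auto elim: evals_ProjE)
  then show ?case using exec_Assign by fastforce
next
  case (Comp f gs)
  let ?m = "length gs"
  obtain ys where ys: "list_all2 (\<lambda>g y. evals g (map s as) y) gs ys" "evals f ys y"
    using Comp.prems(1) by (rule evals_CompE)
  have "\<exists>t. exec (compile_list (map compile gs) as (Suc b)) s t"
    by (rule compile_list_complete[OF Comp.IH(2) ys(1)]) (use Comp.prems(2) in auto)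
  then obtain s1 where s1: "exec (compile_list (map compile gs) as (Suc b)) s s1" ..
  have sub: "set as \<subseteq> {..<Suc b}" using Comp.prems(2) by auto
  have "list_all2 (\<lambda>g y. evals g (map s as) y) gs (map s1 [Suc b..<Suc b + ?m])"
    using compile_list_sound[OF compile_sound s1 sub] by blast
  then have "evals (gs ! i) (map s as) (s1 (Suc b + i))" if "i < ?m" for i
    using that by (auto simp: list_all2_conv_all_nth simp del: upt_Suc)
  then have "ys ! i = s1 (Suc b + i)" if "i < ?m" for i
    using that ys(1) evals_det by (metis list_all2_conv_all_nth)
  moreover have "length ys = ?m" using ys(1) by (simp add: list_all2_lengthD)
  ultimately have "ys = map s1 [Suc b..<Suc b + ?m]"
    by (intro nth_equalityI) (auto simp del: upt_Suc)
  then have "\<exists>s2. exec (compile f [Suc b..<Suc b + ?m] (Suc b + ?m)) s1 s2"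
    using ys(2) by (intro Comp.IH(1)[of s1 _ y]) (simp_all only:, auto)
  then show ?case using s1 by (auto simp: Let_def exec_Seq_iff exec_Assign_iff simp del: upt_Suc)
next
  case (Prec f g)
  have "as \<noteq> []" using Prec.prems(1) by (auto elim: evals_PrecE)
  then obtain a as' where as: "as = a # as'" by (cases as) auto
  have a: "a < b" "set as' \<subseteq> {..<b}" using Prec.prems(2) by (simp_all add: as)
  let ?body = "Seq (compile g ((b + 1) # b # as') (b + 3)) (Seq (Assign b (Copy (b + 3)))
           (Seq (Assign (b + 1) (Incr (b + 1))) (Assign (b + 2) (Decr (b + 2)))))"
  let ?s1 = "s(b + 1 := 0, b + 2 := s a)"
  let ?xs = "map s as'"
  have defined: "\<exists>z. evals (Prec f g) (m # ?xs) z" if "m \<le> s a" for m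
    using evals_Prec_le[of f g "s a" ?xs] Prec.prems(1) that by (auto simp: as)
  have s1: "map ?s1 as' = ?xs" using a by auto
  obtain y0 where y0: "evals f ?xs y0" using defined[of 0] by (auto elim: evals_PrecE)
  then have "evals f (map ?s1 as') y0" by (simp only: s1)
  then have "\<exists>s2. exec (compile f as' (b + 3)) ?s1 s2"
    by (rule Prec.IH(1)) (use a in auto)
  then obtain s2 where s2: "exec (compile f as' (b + 3)) ?s1 s2" ..
  have "evals f (map ?s1 as') (s2 (b + 3)) \<and> agree (b + 3) ?s1 s2"
    by (rule compile_sound[OF s2]) (use a in auto)
  then have f: "evals f ?xs (s2 (b + 3))" "agree (b + 3) ?s1 s2" unfolding s1 by blast+
  have "evals (Prec f g) (0 # ?xs) (s2 (b + 3))" using f(1) by (rule evals.intros(5))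
  note f = this f(2)
  define I where "I = (\<lambda>u. agree b s u \<and> u (b + 1) + u (b + 2) = s a \<and>
    evals (Prec f g) (u (b + 1) # ?xs) (u b))"
  have "\<exists>t. exec (While (b + 2) ?body) (s2(b := s2 (b + 3))) t"
  proof (rule exec_While_terminates[where I = I and m = "\<lambda>u. u (b + 2)"])
    show "I (s2(b := s2 (b + 3)))" using f by (auto simp: I_def agree_def)
    fix u
    assume u: "I u" "u (b + 2) \<noteq> 0"
    have us: "map u as' = ?xs" using u(1) a(2) by (intro agree_map[of b]) (auto simp: I_def)
    obtain z where "evals (Prec f g) (Suc (u (b + 1)) # ?xs) z"
      using defined[of "Suc (u (b + 1))"] u by (auto simp: I_def)
    then obtain z' where "evals (Prec f g) (u (b + 1) # ?xs) z'" "evals g (u (b + 1) # z' # ?xs) z"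
      by (auto elim: evals_PrecE)
    \<comment> \<open>Determinism identifies the value produced by the evaluation rules with the one
      stored in register \<open>b\<close>.\<close>
    moreover from this(1) have "z' = u b" using u(1) evals_det by (auto simp: I_def)
    ultimately have z: "evals g (map u ((b + 1) # b # as')) z" by (simp add: us)
    then have "\<exists>v. exec (compile g ((b + 1) # b # as') (b + 3)) u v"
      by (rule Prec.IH(2)) (use a in auto)
    then obtain v where v: "exec (compile g ((b + 1) # b # as') (b + 3)) u v" ..
    have g: "evals g (map u ((b + 1) # b # as')) (v (b + 3)) \<and> agree (b + 3) u v"
      by (rule compile_sound[OF v]) (use a in auto)
    let ?v = "v(b := v (b + 3), b + 1 := Suc (v (b + 1)), b + 2 := v (b + 2) - 1)"
    have "exec ?body u ?v" using v by (auto simp: exec_Seq_iff exec_Assign_iff)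
    moreover have "I ?v \<and> ?v (b + 2) < u (b + 2)"
      using u g by (auto simp: I_def agree_def us intro!: evals.intros(6)[of f g _ _ "u b"])
    ultimately show "\<exists>u'. exec ?body u u' \<and> I u' \<and> u' (b + 2) < u (b + 2)" by blast
  qed
  then show ?case using s2 a by (simp add: as exec_Seq_iff exec_Assign_iff) blast
next
  case (Mu f)
  let ?run = "compile f (b # as) (b + 1)"
  let ?xs = "map s as"
  have y: "evals f (y # ?xs) 0" "\<And>m. m < y \<Longrightarrow> \<exists>z>0. evals f (m # ?xs) z"
    using Mu.prems(1) by (auto elim: evals_MuE)
  define I where "I = (\<lambda>u. agree b s u \<and> u b \<le> y \<and> evals f (u b # ?xs) (u (b + 1)))"
  have run: "\<exists>v. exec ?run u v \<and> I v \<and> v b = u b" if u: "agree b s u" "u b \<le> y" for u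
  proof -
    have us: "map u (b # as) = u b # ?xs" using agree_map[OF u(1) Mu.prems(2)] by simp
    obtain z where "evals f (u b # ?xs) z" using y u(2) by (metis le_neq_implies_less)
    then have "evals f (map u (b # as)) z" by (simp only: us)
    then have "\<exists>v. exec ?run u v"
      by (rule Mu.IH) (use Mu.prems(2) in auto)
    then obtain v where v: "exec ?run u v" ..
    have "evals f (map u (b # as)) (v (b + 1)) \<and> agree (b + 1) u v"
      by (rule compile_sound[OF v]) (use Mu.prems(2) in auto)
    then have "I v \<and> v b = u b" unfolding us using u by (auto simp: I_def agree_def)
    with v show ?thesis by blast
  qed
  obtain s1 where s1: "exec ?run (s(b := 0)) s1" "I s1"
    using run[of "s(b := 0)"] by (auto simp: agree_def)
  have "\<exists>t. exec (While (b + 1) (Seq (Assign b (Incr b)) ?run)) s1 t"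
  \<comment> \<open>The candidate never passes \<open>y\<close>: as the value at \<open>y\<close> is
    0, a further round only starts with a candidate strictly below \<open>y\<close>.\<close>
  proof (rule exec_While_terminates[where I = I and m = "\<lambda>u. y - u b"])
    fix u
    assume u: "I u" "u (b + 1) \<noteq> 0"
    then have "u b \<noteq> y" using evals_det[of f "u b # ?xs" 0 "u (b + 1)"] y(1) by (auto simp: I_def)
    with u have less: "u b < y" by (auto simp: I_def)
    have "agree b s (u(b := Suc (u b)))" using u(1) by (auto simp: I_def agree_def)
    from run[OF this] less obtain v
      where v: "exec ?run (u(b := Suc (u b))) v" "I v" "v b = Suc (u b)" by auto
    then have "exec (Seq (Assign b (Incr b)) ?run) u v"
      by (auto simp: exec_Seq_iff exec_Assign_iff)
    with v less show "\<exists>u'. exec (Seq (Assign b (Incr b)) ?run) u u' \<and> I u' \<and> y - u' b < y - u b"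
      by (intro exI[of _ v]) auto
  qed (rule s1(2))
  then show ?case using s1(1) by (auto simp: exec_Seq_iff exec_Assign_iff)
qed

theorem compile_correct:
  "set as \<subseteq> {..<b} \<Longrightarrow> (\<exists>t. exec (compile f as b) s t) \<longleftrightarrow> (\<exists>y. evals f (map s as) y)"
  using compile_sound compile_complete by blast

section \<open>Small steps and control states\<close>

text \<open>The stack of pending commands is the control state; the empty stack is the halted state
  and is kept forever.\<close>

fun step :: "cmd list \<times> (nat \<Rightarrow> nat) \<Rightarrow> cmd list \<times> (nat \<Rightarrow> nat)" where
  "step ([], s) = ([], s)"
| "step (Assign i e # k, s) = (k, s(i := rhs_val s e))"
| "step (Seq a b # k, s) = (a # b # k, s)"
| "step (While i a # k, s) = (if s i = 0 then k else a # While i a # k, s)"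

lemma exec_steps: "exec c s t \<Longrightarrow> \<exists>n. (step ^^ n) (c # k, s) = (k, t)"
proof (induction arbitrary: k rule: exec.induct)
  case (exec_Assign i e s)
  show ?case by (rule exI[of _ 1]) (simp add: fun_upd_def)
next
  case (exec_Seq a s s' b t)
  obtain m n where "(step ^^ m) (a # b # k, s) = (b # k, s')" "(step ^^ n) (b # k, s') = (k, t)"
    using exec_Seq.IH by blast
  then have "(step ^^ (n + m + 1)) (Seq a b # k, s) = (k, t)" by (simp add: funpow_add funpow_Suc_right del: funpow.simps(2))
  then show ?case ..
next
  case (exec_While_False s i a)
  then show ?case by (intro exI[of _ 1]) simp
next
  case (exec_While_True s i a s' t)
  obtain m n where "(step ^^ m) (a # While i a # k, s) = (While i a # k, s')"
    "(step ^^ n) (While i a # k, s') = (k, t)"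
    using exec_While_True.IH by blast
  then have "(step ^^ (n + m + 1)) (While i a # k, s) = (k, t)"
    using exec_While_True(1) by (simp add: funpow_add funpow_Suc_right del: funpow.simps(2))
  then show ?case ..
qed

text \<open>A halting run must first complete the head command. Strong induction is used because the
  second command of a sequence, or the next round of a loop, starts with an unknown smaller number
  of steps left.\<close>

lemma steps_exec:
  "(step ^^ n) (c # k, s) = ([], t) \<Longrightarrow> \<exists>m s'. m \<le> n \<and> exec c s s' \<and> (step ^^ m) (k, s') = ([], t)"
proof (induction n arbitrary: c k s rule: less_induct)
  case (less n)
  then obtain n' where n: "n = Suc n'" by (cases n) auto
  have step: "(step ^^ n') (step (c # k, s)) = ([], t)"
    using less.prems by (simp add: n funpow_swap1)
  have two: "\<exists>m s'. m \<le> n \<and> exec a s s' \<and> (\<exists>s''. exec b s' s'' \<and> (step ^^ m) (k, s'') = ([], t))"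
    if ab: "(step ^^ n') (a # b # k, s) = ([], t)" for a b
  proof -
    obtain m s' where m: "m \<le> n'" "exec a s s'" "(step ^^ m) (b # k, s') = ([], t)"
      using less.IH[OF _ ab] by (auto simp: n)
    then obtain m' s'' where "m' \<le> m" "exec b s' s''" "(step ^^ m') (k, s'') = ([], t)"
      using less.IH[OF _ m(3)] by (auto simp: n)
    with m n show ?thesis by (intro exI[of _ m']) auto
  qed
  show ?case
  proof (cases c)
    case (Assign i e)
    with step show ?thesis by (intro exI[of _ n']) (auto simp: n intro: exec_Assign)
  next
    case (Seq a b)
    with step two[of a b] show ?thesis by (auto intro: exec_Seq)
  next
    case (While i a)
    show ?thesis
    proof (cases "s i = 0")
      case True
      with step While show ?thesis by (intro exI[of _ n']) (auto simp: n intro: exec_While_False)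
    next
      case False
      with step While two[of a "While i a"] show ?thesis by (auto intro: exec_While_True)
    qed
  qed
qed

lemma halts_iff_exec: "(\<exists>n. fst ((step ^^ n) ([c], s)) = []) \<longleftrightarrow> (\<exists>t. exec c s t)"
proof
  assume "\<exists>n. fst ((step ^^ n) ([c], s)) = []"
  then obtain n t where "(step ^^ n) ([c], s) = ([], t)" by (metis prod.collapse)
  then show "\<exists>t. exec c s t" using steps_exec by blast
next
  assume "\<exists>t. exec c s t"
  then obtain n t where "(step ^^ n) ([c], s) = ([], t)" using exec_steps by blast
  then show "\<exists>n. fst ((step ^^ n) ([c], s)) = []" by (metis fst_conv)
qed

section \<open>Finitely many control states and registers\<close>

primrec conts :: "cmd \<Rightarrow> cmd list \<Rightarrow> cmd list set" where
  "conts (Assign i e) k = {Assign i e # k}"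
| "conts (Seq a b) k = insert (Seq a b # k) (conts a (b # k) \<union> conts b k)"
| "conts (While i a) k = insert (While i a # k) (conts a (While i a # k))"

lemma finite_conts: "finite (conts c k)"
  by (induction c arbitrary: k) auto

lemma conts_self: "c # k \<in> conts c k"
  by (cases c) auto

text \<open>A loop pushes itself below its body and finds the same stack again after each round, so
  the stacks above \<open>k\<close> form a set closed under steps until \<open>k\<close> is reached.
  With \<open>finite_conts\<close>, finitely many atoms describe the control.\<close>

lemma conts_step: "q \<in> conts c k \<Longrightarrow> fst (step (q, s)) \<in> insert k (conts c k)"
proof (induction c arbitrary: k)
  case (Seq a b)
  show ?case
    using Seq.prems Seq.IH(1)[of "b # k"] Seq.IH(2)[of k] conts_self[of a "b # k"] conts_self[of b k]
    by auto
next
  case (While i a)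
  show ?case
    using While.prems While.IH[of "While i a # k"] conts_self[of a "While i a # k"]
    by (auto split: if_splits)
qed auto

primrec rhs_regs :: "rhs \<Rightarrow> nat set" where
  "rhs_regs Nought = {}"
| "rhs_regs (Copy j) = {j}"
| "rhs_regs (Incr j) = {j}"
| "rhs_regs (Decr j) = {j}"

text \<open>Only registers that are read are collected. Their values, together with the control
  state, determine the further course of control and their own next values.\<close>

primrec regs :: "cmd \<Rightarrow> nat set" where
  "regs (Assign i e) = rhs_regs e"
| "regs (Seq a b) = regs a \<union> regs b"
| "regs (While i a) = insert i (regs a)"

lemma finite_regs: "finite (regs c)"
proof (induction c)
  case (Assign i e)
  show ?case by (cases e) auto
qed auto

lemma conts_regs: "d # k' \<in> conts c k \<Longrightarrow> regs d \<subseteq> regs c"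
  by (induction c arbitrary: k) fastforce+

section \<open>Forcing a grid\<close>

text \<open>The atoms \<open>Name t p\<close> occur in no formula of the reduction. They are private
  names of the points of the grid model, by which updates can single out one point.\<close>

datatype sym = Reg nat | Ctl "cmd list" | Zero_Column | Name nat nat

instance rhs :: countable by countable_datatype
instance cmd :: countable by countable_datatype
instance sym :: countable by countable_datatype

definition Dia :: "'a \<Rightarrow> ('p, 'a) fm \<Rightarrow> ('p, 'a) fm" where
  "Dia a \<phi> = Neg (Box a (Neg \<phi>))"

definition Imp :: "('p, 'a) fm \<Rightarrow> ('p, 'a) fm \<Rightarrow> ('p, 'a) fm" where
  "Imp \<phi> \<psi> = Neg (Conj \<phi> (Neg \<psi>))"

lemma sat_Dia [simp]: "sat M w (Dia a \<phi>) \<longleftrightarrow> (\<exists>v. (w, v) \<in> rel M a \<and> sat M v \<phi>)"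
  by (simp add: Dia_def)

lemma sat_Imp [simp]: "sat M w (Imp \<phi> \<psi>) \<longleftrightarrow> (sat M w \<phi> \<longrightarrow> sat M w \<psi>)"
  by (simp add: Imp_def)

lemma sat_Neg_Arb_Neg:
  "sat M w (Neg (Arb (Neg \<phi>))) \<longleftrightarrow> (\<exists>U. AUL_upd U \<and> sat (update M U) w \<phi>)"
  by auto

lemma AUL_Dia_Imp [simp]: "AUL (Dia a \<phi>) \<longleftrightarrow> AUL \<phi>" "AUL (Imp \<phi> \<psi>) \<longleftrightarrow> AUL \<phi> \<and> AUL \<psi>"
  by (simp_all add: Dia_def Imp_def)

lemma rel_update: "(v, v') \<in> rel (update M U) a \<longleftrightarrow>
    (v, v') \<in> rel M a \<and> (\<exists>(\<phi>, b, \<psi>) \<in> clauses U. b = a \<and> sat M v \<phi> \<and> sat M v' \<psi>)"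
  by (simp add: update.simps)

lemma val_update [simp]: "val (update M U) = val M"
  by (simp add: update.simps)

text \<open>Agent \<open>ra\<close> leads to the next time and \<open>ua\<close> to the next column,
  \<open>sa\<close> links the root with the grid points, and arrows of \<open>ca\<close> serve as
  marks.\<close>

locale encoding =
  fixes at :: "sym \<Rightarrow> 'p" and ra ua sa ca :: "'a"
  assumes inj_at: "inj at" and agents: "distinct [ra, ua, sa, ca]"
begin

section \<open>Marking worlds by updates\<close>

definition Top :: "('p, 'a) fm" where
  "Top = Neg (Conj (Atom (at Zero_Column)) (Neg (Atom (at Zero_Column))))"

lemma sat_Top [simp]: "sat M w Top" by (simp add: Top_def)
lemma AUL_Top [simp]: "AUL Top" by (simp add: Top_def)

primrec conjs :: "('p, 'a) fm list \<Rightarrow> ('p, 'a) fm" where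
  "conjs [] = Top"
| "conjs (\<phi> # \<phi>s) = Conj \<phi> (conjs \<phi>s)"

lemma sat_conjs [simp]: "sat M w (conjs \<phi>s) \<longleftrightarrow> (\<forall>\<phi> \<in> set \<phi>s. sat M w \<phi>)"
  by (induction \<phi>s) auto

lemma AUL_conjs [simp]: "AUL (conjs \<phi>s) \<longleftrightarrow> (\<forall>\<phi> \<in> set \<phi>s. AUL \<phi>)"
  by (induction \<phi>s) auto

text \<open>Updates cannot change atoms but can delete arrows of \<open>ca\<close>. Having such an
  arrow therefore acts as a variable predicate, which \<open>Arb\<close> can restrict to the worlds
  satisfying any AUL formula.\<close>

definition marked :: "('p, 'a) fm" where
  "marked = Dia ca Top"

lemma AUL_marked [simp]: "AUL marked" by (simp add: marked_def)

definition unmark :: "('p, 'a) upd" where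
  "unmark = Snoc (Snoc (Clause Top ra Top) Top ua Top) Top sa Top"

definition mark :: "('p, 'a) fm \<Rightarrow> ('p, 'a) upd" where
  "mark \<phi> = Snoc unmark \<phi> ca Top"

lemma AUL_mark [simp]: "AUL_upd (mark \<phi>) \<longleftrightarrow> AUL \<phi>"
  by (simp add: mark_def unmark_def)

lemma rel_mark:
  "rel (update M (mark \<phi>)) a =
    (if a \<in> {ra, ua, sa} then rel M a else if a = ca then {(v, v') \<in> rel M a. sat M v \<phi>} else {})"
  using agents by (auto simp: rel_update mark_def unmark_def)

lemma rel_unmark: "rel (update M unmark) a = (if a \<in> {ra, ua, sa} then rel M a else {})"
  by (auto simp: rel_update unmark_def)

lemma sat_marked: "sat (update M (mark \<phi>)) v marked \<longleftrightarrow> sat M v marked \<and> sat M v \<phi>"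
  using agents by (auto simp: rel_mark marked_def)

lemma unmark_mark: "update (update M (mark \<phi>)) unmark = update M unmark"
  using agents by (intro model.equality ext) (simp_all add: rel_unmark rel_mark, simp_all add: update.simps)

text \<open>Composes two updates into one: clause formulas are evaluated after
  \<open>unmark\<close>, and clauses of agents whose arrows \<open>unmark\<close> has deleted are
  disabled by a false source condition.\<close>

primrec after_unmark :: "('p, 'a) upd \<Rightarrow> ('p, 'a) upd" where
  "after_unmark (Clause \<phi> a \<psi>) =
    Clause (if a \<in> {ra, ua, sa} then Upd unmark \<phi> else Neg Top) a (Upd unmark \<psi>)"
| "after_unmark (Snoc U \<phi> a \<psi>) =
    Snoc (after_unmark U) (if a \<in> {ra, ua, sa} then Upd unmark \<phi> else Neg Top) a (Upd unmark \<psi>)"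

lemma AUL_after_unmark: "AUL_upd U \<Longrightarrow> AUL_upd (after_unmark U)"
  by (rule upd.induct[of "\<lambda>_. True" "\<lambda>U. AUL_upd U \<longrightarrow> AUL_upd (after_unmark U)", THEN mp])
    (auto simp: unmark_def)

lemma clauses_after_unmark:
  "(\<exists>(\<phi>, b, \<psi>) \<in> clauses (after_unmark U). b = a \<and> sat M v \<phi> \<and> sat M v' \<psi>) \<longleftrightarrow>
    a \<in> {ra, ua, sa} \<and>
    (\<exists>(\<phi>, b, \<psi>) \<in> clauses U. b = a \<and> sat (update M unmark) v \<phi> \<and> sat (update M unmark) v' \<psi>)"
  by (rule upd.induct[of "\<lambda>_. True"]) auto

lemma update_after_unmark: "update M (after_unmark U) = update (update M unmark) U"
proof (intro model.equality ext)
  fix a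
  show "rel (update M (after_unmark U)) a = rel (update (update M unmark) U) a"
    by (rule set_eqI, rule prod.induct) (simp only: rel_update clauses_after_unmark rel_unmark, auto)
qed (simp_all add: update.simps)

text \<open>
  True at a world iff the arrows from it can be pruned to a path via the root to a world that no
  further update tells apart from it; in particular the two worlds satisfy the same atoms.
\<close>

definition seen :: "('p, 'a) fm" where
  "seen = Neg (Arb (Neg (Conj (Conj (Dia ra Top) (Dia sa (Dia sa Top)))
     (Arb (Imp (Dia ra Top) (Box sa (Box sa (Dia ra Top))))))))"

text \<open>Marking only affects arrows that the update witnessing \<open>seen\<close> may as well remove first.\<close>

lemma seen_mark:
  assumes "sat (update M unmark) v seen"
  shows "sat (update M (mark \<phi>)) v seen"
proof -
  let ?N = "update M (mark \<phi>)"
  from assms obtain U where "AUL_upd U" "sat (update (update ?N unmark) U) v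
      (Conj (Conj (Dia ra Top) (Dia sa (Dia sa Top))) (Arb (Imp (Dia ra Top) (Box sa (Box sa (Dia ra Top))))))"
    unfolding seen_def sat_Neg_Arb_Neg unmark_mark by blast
  then show ?thesis
    unfolding seen_def sat_Neg_Arb_Neg update_after_unmark[symmetric] using AUL_after_unmark by blast
qed

text \<open>The fourth conjunct is the key: for the update \<open>mark (Neg \<phi>)\<close> it turns
  a failure of \<phi> at an \<open>a\<close>-successor into a failure directly below the root. Its
  guard \<open>seen\<close> keeps it true in the grid model, where other updates may cut the arrow
  from the root. The fifth conjunct makes \<open>a\<close> deterministic up to AUL formulas.\<close>

definition closed_under :: "'a \<Rightarrow> ('p, 'a) fm" where
  "closed_under a = conjs
    [Box sa (Dia a Top), Box sa (Box a marked), Box sa (Box a (Upd unmark seen)),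
     Arb (Imp (Dia sa (Dia a (Conj marked seen))) (Dia sa marked)),
     Box sa (Arb (Imp (Dia a marked) (Box a marked)))]"

definition grid :: "('p, 'a) fm" where
  "grid = conjs [Box sa marked, closed_under ra, closed_under ua,
     Box sa (Arb (Imp (Dia ra (Dia ua marked)) (Box ua (Box ra marked))))]"

section \<open>Consequences of the grid formula in an arbitrary model\<close>

context
  fixes M :: "('w, 'a, 'p) model" and w0 :: 'w
  assumes grid: "sat M w0 grid"
begin

text \<open>Grid neighbours need not be \<open>sa\<close>-successors of the root themselves. They
  only inherit the AUL formulas that hold at all of these, and this is what later steps use.\<close>

definition good :: "'w set" where
  "good = {w. \<forall>\<phi>. AUL \<phi> \<longrightarrow> (\<forall>w'. (w0, w') \<in> rel M sa \<longrightarrow> sat M w' \<phi>) \<longrightarrow> sat M w \<phi>}"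

lemma goodD: "w \<in> good \<Longrightarrow> AUL \<phi> \<Longrightarrow> (\<And>w'. (w0, w') \<in> rel M sa \<Longrightarrow> sat M w' \<phi>) \<Longrightarrow> sat M w \<phi>"
  unfolding good_def by blast

lemma root_good: "(w0, w) \<in> rel M sa \<Longrightarrow> w \<in> good"
  by (simp add: good_def)

lemma gridD:
  "sat M w0 (Box sa marked)"
  "sat M w0 (closed_under ra)"
  "sat M w0 (closed_under ua)"
  "sat M w0 (Box sa (Arb (Imp (Dia ra (Dia ua marked)) (Box ua (Box ra marked)))))"
  using grid unfolding grid_def sat_conjs by (meson list.set_intros)+

lemma closed_underD:
  assumes "a \<in> {ra, ua}"
  shows "sat M w0 (Box sa (Dia a Top))"
    and "sat M w0 (Box sa (Box a marked))"
    and "sat M w0 (Box sa (Box a (Upd unmark seen)))"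
    and "sat M w0 (Arb (Imp (Dia sa (Dia a (Conj marked seen))) (Dia sa marked)))"
    and "sat M w0 (Box sa (Arb (Imp (Dia a marked) (Box a marked))))"
proof -
  have "sat M w0 (closed_under a)" using assms gridD(2,3) by blast
  then show "sat M w0 (Box sa (Dia a Top))"
    "sat M w0 (Box sa (Box a marked))"
    "sat M w0 (Box sa (Box a (Upd unmark seen)))"
    "sat M w0 (Arb (Imp (Dia sa (Dia a (Conj marked seen))) (Dia sa marked)))"
    "sat M w0 (Box sa (Arb (Imp (Dia a marked) (Box a marked))))"
    unfolding closed_under_def sat_conjs by (meson list.set_intros)+
qed

text \<open>This makes \<open>Box sa\<close> a universal modality for AUL formulas. A counterexample
  to \<phi> after one \<open>a\<close>-step is marked and still seen after
  \<open>mark (Neg \<phi>)\<close>, so some \<open>sa\<close>-successor of the root is marked there,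
  contradicting \<phi> at all of them.\<close>

lemma good_step:
  assumes "a \<in> {ra, ua}" and "w \<in> good" and "(w, v) \<in> rel M a"
  shows "v \<in> good"
  unfolding good_def
proof (intro CollectI allI impI)
  fix \<phi> :: "('p, 'a) fm"
  assume \<phi>: "AUL \<phi>" "\<forall>w'. (w0, w') \<in> rel M sa \<longrightarrow> sat M w' \<phi>"
  have "sat M x' \<phi>" if x: "(w0, x) \<in> rel M sa" "(x, x') \<in> rel M a" for x x'
  proof (rule ccontr)
    assume not: "\<not> sat M x' \<phi>"
    let ?N = "update M (mark (Neg \<phi>))"
    have x': "sat M x' marked" "sat (update M unmark) x' seen"
      using closed_underD(2,3)[OF assms(1)] x by simp_all
    have "sat ?N w0 (Imp (Dia sa (Dia a (Conj marked seen))) (Dia sa marked))"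
      using closed_underD(4)[OF assms(1)] \<phi>(1) by (simp del: sat_Dia sat_Imp)
    moreover have "sat ?N x' marked" "sat ?N x' seen"
      using x' not by (simp_all add: sat_marked seen_mark)
    moreover have "(w0, x) \<in> rel ?N sa" "(x, x') \<in> rel ?N a"
      using x assms(1) by (auto simp: rel_mark)
    ultimately obtain y where "(w0, y) \<in> rel ?N sa" "sat ?N y marked"
      unfolding sat_Imp sat_Dia sat.simps(3) by blast
    then have "(w0, y) \<in> rel M sa" "\<not> sat M y \<phi>"
      by (simp_all add: sat_marked rel_mark)
    with \<phi>(2) show False by blast
  qed
  \<comment> \<open>\<open>Box a \<phi>\<close> is itself an AUL formula true at all
    \<open>sa\<close>-successors of the root, so it passes to the good world
    \<open>w\<close>.\<close>
  then have "sat M w (Box a \<phi>)" using \<phi>(1) by (intro goodD[OF assms(2)]) auto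
  with assms(3) show "sat M v \<phi>" by simp
qed

lemma good_serial:
  assumes "a \<in> {ra, ua}" and "w \<in> good"
  shows "\<exists>v. (w, v) \<in> rel M a"
proof -
  have "sat M w (Dia a Top)"
    by (rule goodD[OF assms(2)]) (use closed_underD(1)[OF assms(1)] in simp_all)
  then show ?thesis by auto
qed

lemma good_marked:
  assumes "w \<in> good"
  shows "sat M w marked"
  by (rule goodD[OF assms]) (use gridD(1) in simp_all)

text \<open>After \<open>mark \<phi>\<close>, marks among the \<open>a\<close>-successors of an
  \<open>sa\<close>-successor of the root coincide with \<phi>, so the conjunct about marks becomes
  determinism for \<phi>. The resulting implication is an AUL formula and transfers to
  \<open>w\<close>. Successors may still be many, but they agree on AUL formulas.\<close>

lemma good_deterministic:
  assumes "a \<in> {ra, ua}" and "w \<in> good" and "AUL \<phi>" and "(w, v) \<in> rel M a" and "sat M v \<phi>"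
  shows "sat M w (Box a \<phi>)"
proof -
  have "sat M x (Imp (Dia a \<phi>) (Box a \<phi>))" if x: "(w0, x) \<in> rel M sa" for x
  proof -
    let ?N = "update M (mark \<phi>)"
    have N: "sat ?N x (Imp (Dia a marked) (Box a marked))"
      using closed_underD(5)[OF assms(1)] x assms(3) by (simp del: sat_Dia sat_Imp)
    have "sat M y marked" if "(x, y) \<in> rel M a" for y
      using that x assms(1) good_step root_good good_marked by blast
    moreover have "rel ?N a = rel M a" using assms(1) by (auto simp: rel_mark)
    ultimately have *: "rel ?N a = rel M a"
      "\<And>y. (x, y) \<in> rel M a \<Longrightarrow> sat ?N y marked \<longleftrightarrow> sat M y \<phi>" by (simp_all add: sat_marked)
    have "sat ?N x (Dia a marked) \<longleftrightarrow> sat M x (Dia a \<phi>)" "sat ?N x (Box a marked) \<longleftrightarrow> sat M x (Box a \<phi>)"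
      using * by auto
    with N show ?thesis by simp
  qed
  then have "sat M w (Imp (Dia a \<phi>) (Box a \<phi>))" using assms(3) by (intro goodD[OF assms(2)]) auto
  with assms(4,5) show ?thesis by auto
qed

lemma good_Box_iff:
  assumes "a \<in> {ra, ua}" and "w \<in> good" and "AUL \<phi>" and "(w, v) \<in> rel M a"
  shows "sat M w (Box a \<phi>) \<longleftrightarrow> sat M v \<phi>"
  using good_deterministic[OF assms] assms(4) by (meson sat.simps(4))

lemma good_commute:
  assumes "w \<in> good" and "AUL \<phi>" and "(w, v) \<in> rel M ra" and "(v, v') \<in> rel M ua" and "sat M v' \<phi>"
  shows "sat M w (Box ua (Box ra \<phi>))"
proof -
  have "sat M x (Imp (Dia ra (Dia ua \<phi>)) (Box ua (Box ra \<phi>)))" if x: "(w0, x) \<in> rel M sa" for x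
  proof -
    let ?N = "update M (mark \<phi>)"
    have N: "sat ?N x (Imp (Dia ra (Dia ua marked)) (Box ua (Box ra marked)))"
      using gridD(4) x assms(2) by (simp del: sat_Dia sat_Imp)
    have m: "sat M y marked" if "(x, z) \<in> rel M ra \<and> (z, y) \<in> rel M ua \<or> (x, z) \<in> rel M ua \<and> (z, y) \<in> rel M ra" for y z
      using that x good_step root_good good_marked by blast
    have *: "rel ?N ra = rel M ra" "rel ?N ua = rel M ua" by (auto simp: rel_mark)
    have "sat ?N y marked \<longleftrightarrow> sat M y \<phi>" if "(x, z) \<in> rel M ra" "(z, y) \<in> rel M ua" for y z
      unfolding sat_marked using m that by blast
    moreover have "sat ?N y marked \<longleftrightarrow> sat M y \<phi>" if "(x, z) \<in> rel M ua" "(z, y) \<in> rel M ra" for y z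
      unfolding sat_marked using m that by blast
    ultimately
    have "sat ?N x (Dia ra (Dia ua marked)) \<longleftrightarrow> sat M x (Dia ra (Dia ua \<phi>))"
      "sat ?N x (Box ua (Box ra marked)) \<longleftrightarrow> sat M x (Box ua (Box ra \<phi>))"
      unfolding sat_Dia sat.simps * by blast+
    with N show ?thesis by simp
  qed
  then have "sat M w (Imp (Dia ra (Dia ua \<phi>)) (Box ua (Box ra \<phi>)))"
    using assms(2) by (intro goodD[OF assms(1)]) auto
  with assms(3-5) show ?thesis by auto
qed

text \<open>\<open>x t p\<close> is reached by \<open>t\<close> chosen \<open>ra\<close>-steps and
  then \<open>p\<close> chosen \<open>ua\<close>-steps. The \<open>ra\<close>-successors of
  \<open>x t p\<close> need not include \<open>x (Suc t) p\<close>, but commutation makes them agree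
  with it on AUL formulas, by induction on \<open>p\<close>.\<close>

lemma ex_grid:
  assumes "(w0, w) \<in> rel M sa"
  obtains x where "x 0 0 = w" and "\<And>t p. x t p \<in> good"
    and "\<And>t p \<phi>. AUL \<phi> \<Longrightarrow> sat M (x t p) (Box ra \<phi>) \<longleftrightarrow> sat M (x (Suc t) p) \<phi>"
    and "\<And>t p \<phi>. AUL \<phi> \<Longrightarrow> sat M (x t p) (Box ua \<phi>) \<longleftrightarrow> sat M (x t (Suc p)) \<phi>"
proof -
  define r where "r = (\<lambda>w. SOME v. (w, v) \<in> rel M ra)"
  define u where "u = (\<lambda>w. SOME v. (w, v) \<in> rel M ua)"
  have r: "(w, r w) \<in> rel M ra" and u: "(w, u w) \<in> rel M ua" if "w \<in> good" for w
    unfolding r_def u_def by (rule someI_ex, use that good_serial in blast)+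
  have rg: "r w \<in> good" and ug: "u w \<in> good" if "w \<in> good" for w
    using that r u good_step by blast+
  define x where "x = (\<lambda>t p. (u ^^ p) ((r ^^ t) w))"
  have good0: "(r ^^ t) w \<in> good" for t
    by (induction t) (use assms root_good rg in auto)
  have good: "x t p \<in> good" for t p
    unfolding x_def by (induction p) (use good0 ug in auto)
  have det: "sat M w (Box ra \<phi>) \<longleftrightarrow> sat M (r w) \<phi>" "sat M w (Box ua \<phi>) \<longleftrightarrow> sat M (u w) \<phi>"
    if "w \<in> good" "AUL \<phi>" for w \<phi>
    by (rule good_Box_iff[OF _ that r[OF that(1)]], simp, rule good_Box_iff[OF _ that u[OF that(1)]], simp)
  have comm: "sat M (u (r w)) \<phi> \<longleftrightarrow> sat M (r (u w)) \<phi>" if "w \<in> good" "AUL \<phi>" for w \<phi>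
  proof -
    have imp: "sat M (r (u w)) \<psi>" if "AUL \<psi>" "sat M (u (r w)) \<psi>" for \<psi>
    proof -
      have "sat M w (Box ua (Box ra \<psi>))"
        by (rule good_commute[OF \<open>w \<in> good\<close> that(1) r[OF \<open>w \<in> good\<close>] u[OF rg[OF \<open>w \<in> good\<close>]] that(2)])
      then show ?thesis
        using det(2)[OF \<open>w \<in> good\<close>] det(1)[OF ug[OF \<open>w \<in> good\<close>]] that(1) by (simp del: sat.simps)
    qed
    \<comment> \<open>Applying the one-way transfer to the negation as well gives
      equivalence.\<close>
    show ?thesis using imp[of \<phi>] imp[of "Neg \<phi>"] \<open>AUL \<phi>\<close> by (simp only: AUL.simps sat.simps) blast
  qed
  have row: "sat M (x t p) (Box ra \<phi>) \<longleftrightarrow> sat M (x (Suc t) p) \<phi>" if "AUL \<phi>" for t p \<phi>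
    using that
  proof (induction p arbitrary: \<phi>)
    case 0
    then show ?case using det(1)[OF good0] by (simp add: x_def del: sat.simps)
  next
    case (Suc p)
    have "sat M (x t (Suc p)) (Box ra \<phi>) \<longleftrightarrow> sat M (r (u (x t p))) \<phi>"
      using det(1)[OF ug[OF good] Suc.prems] by (simp add: x_def del: sat.simps)
    also have "\<dots> \<longleftrightarrow> sat M (u (r (x t p))) \<phi>" using comm[OF good Suc.prems] by simp
    also have "\<dots> \<longleftrightarrow> sat M (x t p) (Box ra (Box ua \<phi>))"
      using det(1)[OF good, of "Box ua \<phi>"] det(2)[OF rg[OF good] Suc.prems] Suc.prems
      by (simp del: sat.simps(4))
    also have "\<dots> \<longleftrightarrow> sat M (x (Suc t) p) (Box ua \<phi>)" using Suc by (simp del: sat.simps)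
    also have "\<dots> \<longleftrightarrow> sat M (x (Suc t) (Suc p)) \<phi>"
      using det(2)[OF good[of "Suc t" p] Suc.prems] by (simp add: x_def del: sat.simps)
    finally show ?case .
  qed
  have col: "sat M (x t p) (Box ua \<phi>) \<longleftrightarrow> sat M (x t (Suc p)) \<phi>" if "AUL \<phi>" for t p \<phi>
    using det(2)[OF good that] by (simp add: x_def del: sat.simps)
  show ?thesis by (rule that[of x, OF _ good row col]) (simp add: x_def)
qed

end

subsection \<open>Computations on the grid\<close>

abbreviation ctl :: "cmd list \<Rightarrow> ('p, 'a) fm" where "ctl q \<equiv> Atom (at (Ctl q))"
abbreviation reg :: "nat \<Rightarrow> ('p, 'a) fm" where "reg l \<equiv> Atom (at (Reg l))"
abbreviation zero :: "('p, 'a) fm" where "zero \<equiv> Atom (at Zero_Column)"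

text \<open>
  Time runs along \<open>ra\<close>. Column \<open>p\<close> of row \<open>t\<close> satisfies \<open>reg l\<close> iff register \<open>l\<close> exceeds \<open>p\<close>
  at time \<open>t\<close>; branching only looks at column 0, and \<open>spread\<close> copies the control state.
\<close>

fun control :: "cmd list \<Rightarrow> ('p, 'a) fm" where
  "control [] = Neg (ctl [])"
| "control (Assign i e # k) = Imp (Conj zero (ctl (Assign i e # k))) (Box ra (ctl k))"
| "control (Seq a b # k) = Imp (Conj zero (ctl (Seq a b # k))) (Box ra (ctl (a # b # k)))"
| "control (While i a # k) = Imp (Conj zero (ctl (While i a # k)))
     (Conj (Imp (Neg (reg i)) (Box ra (ctl k))) (Imp (reg i) (Box ra (ctl (a # While i a # k)))))"

definition spread :: "cmd list \<Rightarrow> ('p, 'a) fm" where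
  "spread q = Imp (ctl q) (Box ua (ctl q))"

text \<open>Reads a step as a simultaneous assignment to all registers, so that one kind of rule
  describes every register.\<close>

fun rhs_at :: "cmd list \<Rightarrow> nat \<Rightarrow> rhs" where
  "rhs_at (Assign i e # k) l = (if l = i then e else Copy l)"
| "rhs_at q l = Copy l"

text \<open>In unary, increment shifts the columns up by one and fills column 0 separately;
  decrement reads the next column, which also gives 0 when the register is 0.\<close>

fun transfer :: "cmd list \<Rightarrow> nat \<Rightarrow> rhs \<Rightarrow> ('p, 'a) fm" where
  "transfer q l Nought = Imp (ctl q) (Box ra (Neg (reg l)))"
| "transfer q l (Copy j) = Imp (ctl q)
     (Conj (Imp (reg j) (Box ra (reg l))) (Imp (Neg (reg j)) (Box ra (Neg (reg l)))))"
| "transfer q l (Incr j) = Conj (Imp (Conj zero (ctl q)) (Box ra (reg l))) (Imp (ctl q)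
     (Conj (Imp (reg j) (Box ra (Box ua (reg l)))) (Imp (Neg (reg j)) (Box ra (Box ua (Neg (reg l)))))))"
| "transfer q l (Decr j) = Imp (ctl q)
     (Conj (Imp (Box ua (reg j)) (Box ra (reg l))) (Imp (Box ua (Neg (reg j))) (Box ra (Neg (reg l)))))"

definition rules :: "cmd list list \<Rightarrow> nat \<Rightarrow> ('p, 'a) fm" where
  "rules Q N = conjs ([Imp zero (Box ra zero)] @ map (\<lambda>l. Imp (Neg (reg l)) (Box ua (Neg (reg l)))) [0..<N]
     @ map control Q @ map spread Q @ concat (map (\<lambda>q. map (\<lambda>l. transfer q l (rhs_at q l)) [0..<N]) Q))"

lemma sat_rules:
  "sat M w (rules Q N) \<longleftrightarrow> sat M w (Imp zero (Box ra zero)) \<and>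
    (\<forall>l<N. sat M w (Imp (Neg (reg l)) (Box ua (Neg (reg l))))) \<and>
    (\<forall>q \<in> set Q. sat M w (control q)) \<and> (\<forall>q \<in> set Q. sat M w (spread q)) \<and>
    (\<forall>q \<in> set Q. \<forall>l<N. sat M w (transfer q l (rhs_at q l)))"
  unfolding rules_def sat_conjs by (auto simp: ball_Un simp del: sat.simps sat_Imp)

lemma AUL_rules [simp]: "AUL (rules Q N)"
proof -
  have "AUL (control q)" for q by (cases q rule: control.cases) auto
  moreover have "AUL (transfer q l e)" for q l e by (cases e) auto
  ultimately show ?thesis by (auto simp: rules_def spread_def)
qed

text \<open>Register 0 is fixed up to column \<open>n\<close>, where it is false; the rules carry
  falsity upwards. Only this part of the reduction depends on the argument.\<close>

primrec input :: "nat \<Rightarrow> ('p, 'a) fm" where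
  "input 0 = Neg (reg 0)"
| "input (Suc n) = Conj (reg 0) (Box ua (input n))"

lemma AUL_input [simp]: "AUL (input n)"
  by (induction n) auto

definition start :: "cmd \<Rightarrow> nat \<Rightarrow> ('p, 'a) fm" where
  "start c N = conjs ([zero, ctl [c]] @ map (\<lambda>l. Neg (reg l)) [1..<N])"

text \<open>Divergence is enforced by \<open>control []\<close>, one of the rules if
  \<open>Q\<close> contains the halted state: it forbids that state at every point.\<close>

definition diverges :: "cmd list list \<Rightarrow> nat \<Rightarrow> cmd \<Rightarrow> nat \<Rightarrow> ('p, 'a) fm" where
  "diverges Q N c n = Conj (Conj grid (Box sa (rules Q N))) (Dia sa (Conj (start c N) (input n)))"

end

definition input_state :: "nat \<Rightarrow> nat \<Rightarrow> nat" where
  "input_state n = (\<lambda>i. if i = 0 then n else 0)"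

definition config :: "cmd \<Rightarrow> nat \<Rightarrow> nat \<Rightarrow> cmd list \<times> (nat \<Rightarrow> nat)" where
  "config c n t = (step ^^ t) ([c], input_state n)"

lemma config_Suc: "config c n (Suc t) = step (config c n t)"
  by (simp add: config_def)

locale machine = encoding at ra ua sa ca
  for at :: "sym \<Rightarrow> 'p" and ra ua sa ca :: 'a +
  fixes Q :: "cmd list list" and N :: nat and c :: cmd
  assumes Q: "set Q = insert [] (conts c [])" and N: "0 < N" "regs c \<subseteq> {..<N}"
begin

section \<open>Rows of an arbitrary model follow the computation\<close>

lemma config_in_Q: "fst (config c n t) \<in> set Q"
proof (induction t)
  case 0
  show ?case using conts_self[of c "[]"] by (simp add: config_def Q)
next
  case (Suc t)
  obtain q s where qs: "config c n t = (q, s)" by fastforce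
  with Suc show ?case using conts_step[of q c "[]" s] by (auto simp: config_Suc Q)
qed

lemma config_regs: "fst (config c n t) = d # k \<Longrightarrow> regs d \<subseteq> {..<N}"
  using config_in_Q[of n t] conts_regs[of d k c "[]"] N(2) by (auto simp: Q)

lemma step_reg:
  "fst (config c n t) \<noteq> [] \<Longrightarrow> snd (config c n (Suc t)) l = rhs_val (snd (config c n t)) (rhs_at (fst (config c n t)) l)"
  by (cases "config c n t" rule: step.cases) (auto simp: config_Suc)

lemma rhs_at_regs: "l < N \<Longrightarrow> rhs_regs (rhs_at (fst (config c n t)) l) \<subseteq> {..<N}"
  using config_regs[of n t] by (cases "(fst (config c n t), l)" rule: rhs_at.cases) (auto split: if_splits)

theorem diverges_sound:
  assumes sat: "sat M w0 (diverges Q N c n)"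
  shows "fst (config c n t) \<noteq> []"
proof -
  have grid: "sat M w0 grid" and rules0: "sat M w0 (Box sa (rules Q N))"
    using sat unfolding diverges_def sat.simps(3) by blast+
  obtain w where w: "(w0, w) \<in> rel M sa" "sat M w (start c N)" "sat M w (input n)"
    using sat unfolding diverges_def sat_Dia sat.simps(3) by blast
  obtain x where x: "x 0 0 = w" "\<And>t p. x t p \<in> good M w0"
    and at_ra: "\<And>t p \<phi>. AUL \<phi> \<Longrightarrow> sat M (x t p) (Box ra \<phi>) \<longleftrightarrow> sat M (x (Suc t) p) \<phi>"
    and at_ua: "\<And>t p \<phi>. AUL \<phi> \<Longrightarrow> sat M (x t p) (Box ua \<phi>) \<longleftrightarrow> sat M (x t (Suc p)) \<phi>"
    using ex_grid[OF grid w(1)] by metis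
  note sat.simps(4) [simp del] at_ra [simp] at_ua [simp]
  let ?T = "\<lambda>t p y. sat M (x t p) (Atom (at y))"
  \<comment> \<open>The rules form an AUL formula, so they pass from the
    \<open>sa\<close>-successors of the root to all grid points.\<close>
  have rules: "sat M (x t p) (rules Q N)" for t p
    by (rule goodD[OF grid x(2) AUL_rules]) (use rules0 in \<open>unfold sat.simps(4), blast\<close>)
  note rules' = rules[unfolded sat_rules]
  have zero: "?T (Suc t) p Zero_Column" if "?T t p Zero_Column" for t p
    using rules'[of t p] that by simp
  have down: "\<not> ?T t (Suc p) (Reg l)" if "\<not> ?T t p (Reg l)" "l < N" for t p l
  proof -
    have "sat M (x t p) (Imp (Neg (reg l)) (Box ua (Neg (reg l))))" using rules' that(2) by blast
    with that(1) show ?thesis by simp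
  qed
  have control: "sat M (x t p) (control q)" if "q \<in> set Q" for t p q
    using rules' that by blast
  have spread: "?T t (Suc p) (Ctl q)" if "q \<in> set Q" "?T t p (Ctl q)" for t p q
  proof -
    have "sat M (x t p) (spread q)" using rules' that(1) by blast
    with that(2) show ?thesis by (simp add: spread_def)
  qed
  have transfer: "sat M (x t p) (transfer q l (rhs_at q l))" if "q \<in> set Q" "l < N" for t p q l
    using rules' that by blast
  define inv where "inv = (\<lambda>t. ?T t 0 Zero_Column \<and> (\<forall>p. ?T t p (Ctl (fst (config c n t)))) \<and>
    (\<forall>l<N. \<forall>p. ?T t p (Reg l) \<longleftrightarrow> p < snd (config c n t) l))"
  have spread_all: "\<forall>p. ?T t p (Ctl q)" if "q \<in> set Q" "?T t 0 (Ctl q)" for t q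
  proof
    fix p show "?T t p (Ctl q)" by (induction p) (use that spread in auto)
  qed
  have inv: "inv t" for t
  proof (induction t)
    case 0
    \<comment> \<open>The starting column \<open>p\<close> is generalised because
      \<open>input\<close> recurses by moving one column up.\<close>
    have input: "sat M (x 0 p) (input m) \<Longrightarrow> ?T 0 (p + i) (Reg 0) \<longleftrightarrow> i < m" for p m i
    proof (induction m arbitrary: p i)
      case 0
      then have "\<not> ?T 0 (p + i) (Reg 0)" by (induction i) (use down[of 0 _ 0] N(1) in auto)
      then show ?case by simp
    next
      case (Suc m)
      then show ?case using Suc.IH[of "Suc p" "i - 1"] by (cases i) auto
    qed
    have "\<not> ?T 0 p (Reg l)" if "1 \<le> l" "l < N" for l p
    proof (induction p)
      case 0
      show ?case using w(2) that x(1) by (auto simp: start_def)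
    qed (use down that in auto)
    moreover have "?T 0 p (Reg 0) \<longleftrightarrow> p < n" for p using input[of 0 n p] w(3) x(1) by simp
    moreover have "\<forall>p. ?T 0 p (Ctl [c])"
      by (rule spread_all) (use w(2) x(1) conts_self[of c "[]"] in \<open>auto simp: start_def Q\<close>)
    ultimately show ?case
      using w(2) x(1) by (auto simp: inv_def config_def input_state_def start_def not_less_eq_eq)
  next
    case (Suc t)
    obtain q s where qs: "config c n t = (q, s)" by fastforce
    have q: "q \<in> set Q" using config_in_Q[of n t] by (simp add: qs)
    have ctl: "?T t p (Ctl q)" for p using Suc by (simp add: inv_def qs)
    have reg: "?T t p (Reg l) \<longleftrightarrow> p < s l" if "l < N" for l p using Suc that by (simp add: inv_def qs)
    have "q \<noteq> []" using control[OF q, of t 0] ctl[of 0] by auto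
    have z: "?T t 0 Zero_Column" using Suc by (simp add: inv_def)
    have "?T (Suc t) 0 (Ctl (fst (config c n (Suc t))))"
    proof (cases q rule: control.cases)
      case (4 i a k)
      then have "i < N" using config_regs[of n t] by (simp add: qs)
      then show ?thesis using control[OF q, of t 0] ctl[of 0] z reg[of i 0] by (simp add: 4 config_Suc qs)
    qed (use control[OF q, of t 0] ctl[of 0] z \<open>q \<noteq> []\<close> in \<open>auto simp: config_Suc qs\<close>)
    then have ctl': "\<forall>p. ?T (Suc t) p (Ctl (fst (config c n (Suc t))))"
      by (rule spread_all[OF config_in_Q])
    have "?T (Suc t) p (Reg l) \<longleftrightarrow> p < rhs_val s (rhs_at q l)" if "l < N" for l p
    proof -
      have e: "rhs_regs (rhs_at q l) \<subseteq> {..<N}" using rhs_at_regs[OF that, of n t] by (simp add: qs)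
      note tr = transfer[OF q that]
      show ?thesis
      proof (cases "rhs_at q l")
        case Nought
        then show ?thesis using tr[of t p] ctl[of p] by simp
      next
        case (Copy j)
        then show ?thesis using tr[of t p] ctl[of p] e reg[of j p] by auto
      next
        case (Incr j)
        show ?thesis
        proof (cases p)
          case 0
          then show ?thesis using tr[of t 0] ctl[of 0] z Incr by simp
        next
          case (Suc p')
          then show ?thesis using tr[of t p'] ctl[of p'] e reg[of j p'] Incr by auto
        qed
      next
        case (Decr j)
        then show ?thesis using tr[of t p] ctl[of p] e reg[of j "Suc p"] by auto
      qed
    qed
    then have "\<forall>l<N. \<forall>p. ?T (Suc t) p (Reg l) \<longleftrightarrow> p < snd (config c n (Suc t)) l"
      using step_reg[of n t] \<open>q \<noteq> []\<close> by (simp add: qs)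
    with ctl' zero[OF z] show ?case by (simp add: inv_def)
  qed
  show ?thesis
  proof
    assume "fst (config c n t) = []"
    then have "?T t 0 (Ctl [])" using inv[of t] by (simp add: inv_def)
    moreover have "sat M (x t 0) (control [])" by (rule control) (simp add: Q)
    ultimately show False by simp
  qed
qed

end

context machine
begin

subsection \<open>The intended model\<close>

fun holds :: "nat \<Rightarrow> sym \<Rightarrow> nat \<Rightarrow> nat \<Rightarrow> bool" where
  "holds n (Reg l) t p \<longleftrightarrow> p < snd (config c n t) l"
| "holds n (Ctl q) t p \<longleftrightarrow> q = fst (config c n t)"
| "holds n Zero_Column t p \<longleftrightarrow> p = 0"
| "holds n (Name t' p') t p \<longleftrightarrow> t' = t \<and> p' = p"

text \<open>The root is \<open>None\<close>.\<close>

definition grid_model :: "nat \<Rightarrow> ((nat \<times> nat) option, 'a, 'p) model" where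
  "grid_model n = \<lparr>worlds = UNIV,
     rel = (\<lambda>a. if a = ra then {(Some (t, p), Some (Suc t, p)) | t p. True}
       else if a = ua then {(Some (t, p), Some (t, Suc p)) | t p. True}
       else if a = sa then {(None, Some x) | x. True} \<union> {(Some x, None) | x. True}
       else if a = ca then Id else {}),
     val = (\<lambda>P. {Some (t, p) | t p. \<exists>y. P = at y \<and> holds n y t p})\<rparr>"

lemma rel_grid_model [simp]:
  "(Some (t, p), v) \<in> rel (grid_model n) ra \<longleftrightarrow> v = Some (Suc t, p)"
  "(Some (t, p), v) \<in> rel (grid_model n) ua \<longleftrightarrow> v = Some (t, Suc p)"
  "(Some x, v) \<in> rel (grid_model n) sa \<longleftrightarrow> v = None"
  "(None, v) \<in> rel (grid_model n) sa \<longleftrightarrow> (\<exists>x. v = Some x)"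
  "(w, v) \<in> rel (grid_model n) ca \<longleftrightarrow> w = v"
  using agents by (auto simp: grid_model_def)

lemma val_grid_model [simp]:
  "Some (t, p) \<in> val (grid_model n) (at y) \<longleftrightarrow> holds n y t p"
  "None \<notin> val (grid_model n) P"
  using inj_at by (auto simp: grid_model_def dest: injD)

lemma sat_name [simp]:
  "val M = val (grid_model n) \<Longrightarrow> sat M w (Atom (at (Name t p))) \<longleftrightarrow> w = Some (t, p)"
  by (cases w) auto

text \<open>Covers everything that iterated updates can make of the grid model: arrows disappear,
  atoms stay.\<close>

definition submodel :: "nat \<Rightarrow> ((nat \<times> nat) option, 'a, 'p) model \<Rightarrow> bool" where
  "submodel n M \<longleftrightarrow> (\<forall>a. rel M a \<subseteq> rel (grid_model n) a) \<and> val M = val (grid_model n)"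

lemma submodel_refl: "submodel n (grid_model n)"
  by (simp add: submodel_def)

lemma submodel_update: "submodel n M \<Longrightarrow> submodel n (update M U)"
  unfolding submodel_def by (simp add: subset_iff rel_update)

lemma submodel_rel: "submodel n M \<Longrightarrow> (w, v) \<in> rel M a \<Longrightarrow> (w, v) \<in> rel (grid_model n) a"
  by (auto simp: submodel_def)

lemma submodel_step:
  assumes "submodel n M"
  shows "(Some (t, p), v) \<in> rel M ra \<Longrightarrow> v = Some (Suc t, p)"
    and "(Some (t, p), v) \<in> rel M ua \<Longrightarrow> v = Some (t, Suc p)"
  by (auto dest!: submodel_rel[OF assms])

text \<open>The \<open>sa\<close>-path witnessing \<open>seen\<close> goes from the point to the
  root and on to some \<open>z\<close>. An update by the private name of the point separates it from
  every other point, so \<open>z\<close> is the point itself and the arrow from the root has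
  survived.\<close>

lemma seen_imp_root_arrow:
  assumes M: "submodel n M" and "sat M (Some (t, p)) seen"
  shows "(None, Some (t, p)) \<in> rel M sa"
proof -
  let ?w = "Some (t, p)"
  obtain U where U: "sat (update M U) ?w (Conj (Dia ra Top) (Dia sa (Dia sa Top)))"
    "sat (update M U) ?w (Arb (Imp (Dia ra Top) (Box sa (Box sa (Dia ra Top)))))"
    using assms(2) unfolding seen_def sat_Neg_Arb_Neg sat.simps(3) by blast
  let ?M = "update M U"
  have M': "submodel n ?M" using M by (rule submodel_update)
  obtain v y z where vyz: "(?w, v) \<in> rel ?M ra" "(?w, y) \<in> rel ?M sa" "(y, z) \<in> rel ?M sa"
    using U(1) by auto
  have y: "y = None" using submodel_rel[OF M' vyz(2)] by simp
  \<comment> \<open>This update keeps \<open>ra\<close>-arrows only at \<open>?w\<close> and leaves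
    \<open>sa\<close> alone, so an \<open>ra\<close>-arrow at \<open>z\<close> identifies
    \<open>z\<close> with \<open>?w\<close>.\<close>
  let ?V = "Snoc (Clause (Atom (at (Name t p))) ra Top) Top sa Top"
  have V: "(a, b) \<in> rel (update ?M ?V) ra \<longleftrightarrow> (a, b) \<in> rel ?M ra \<and> a = ?w"
    "(a, b) \<in> rel (update ?M ?V) sa \<longleftrightarrow> (a, b) \<in> rel ?M sa" for a b
    using agents M' by (auto simp: rel_update submodel_def simp del: sat.simps(1))
  have "sat (update ?M ?V) ?w (Imp (Dia ra Top) (Box sa (Box sa (Dia ra Top))))"
    using U(2) unfolding sat.simps(6) sat.simps(5) by (metis AUL.simps(1) AUL_Top AUL_upd.simps)
  then have "z = ?w" using vyz by (auto simp: V)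
  with vyz(3) y show ?thesis by (simp add: rel_update)
qed

text \<open>The witnessing update keeps of \<open>sa\<close> only the two arrows between the point
  and the root. Two \<open>sa\<close>-steps from the point then lead back to it, whatever is deleted
  later.\<close>

lemma seen_grid_model: "sat (update (grid_model n) unmark) (Some (t, p)) seen"
proof -
  let ?w = "Some (t, p)"
  let ?U = "Snoc (Snoc (Clause Top ra Top) Top sa (Atom (at (Name t p)))) (Atom (at (Name t p))) sa Top"
  let ?M = "update (grid_model n) unmark"
  let ?N = "update ?M ?U"
  have ra: "(a, b) \<in> rel ?N ra \<longleftrightarrow> (a, b) \<in> rel (grid_model n) ra"
    and sa: "(a, b) \<in> rel ?N sa \<longleftrightarrow> (a, b) \<in> rel (grid_model n) sa \<and> (a = ?w \<or> b = ?w)" for a b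
    using agents by (auto simp: rel_update[of _ _ ?M] rel_unmark simp del: sat.simps(1))
  have "sat ?N ?w (Conj (Dia ra Top) (Dia sa (Dia sa Top)))"
    by (auto simp: ra sa)
  moreover have "sat ?N ?w (Arb (Imp (Dia ra Top) (Box sa (Box sa (Dia ra Top)))))"
  proof -
    have "z = ?w" if "(?w, y) \<in> rel (update ?N V) sa" "(y, z) \<in> rel (update ?N V) sa" for V y z
      using that by (auto simp: rel_update[of _ _ ?N] sa)
    then show ?thesis by fastforce
  qed
  ultimately show ?thesis
    unfolding seen_def sat_Neg_Arb_Neg sat.simps(3)
    by (intro exI[of _ ?U] conjI) auto
qed

text \<open>For the fourth conjunct, \<open>seen\<close> at the \<open>a\<close>-successor shows
  that its arrow from the root is still present, so this successor is itself the required marked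
  world. Determinism persists because updates only delete arrows.\<close>

lemma closed_under_grid_model:
  assumes "a = ra \<or> a = ua"
  shows "sat (grid_model n) None (closed_under a)"
proof -
  have step: "\<exists>t' p'. v = Some (t', p')" if "(Some (t, p), v) \<in> rel (grid_model n) a" for t p v
    using assms that by auto
  have det: "v = v'" if "(Some (t, p), v) \<in> rel (grid_model n) a" "(Some (t, p), v') \<in> rel (grid_model n) a" for t p v v'
    using assms that by auto
  have serial: "sat (grid_model n) (Some (t, p)) (Dia a Top)" for t p
    using assms by auto
  have m: "sat (grid_model n) w marked" for w by (simp add: marked_def)
  have seen: "sat (update (grid_model n) unmark) v seen" if "(Some (t, p), v) \<in> rel (grid_model n) a" for t p v
    using step[OF that] seen_grid_model by auto
  have 4: "sat (update (grid_model n) U) None (Imp (Dia sa (Dia a (Conj marked seen))) (Dia sa marked))" for U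
  proof -
    let ?M = "update (grid_model n) U"
    have M: "submodel n ?M" by (rule submodel_update[OF submodel_refl])
    show ?thesis unfolding sat_Imp
    proof
      assume "sat ?M None (Dia sa (Dia a (Conj marked seen)))"
      then obtain w v where wv: "(None, w) \<in> rel ?M sa" "(w, v) \<in> rel ?M a" "sat ?M v marked" "sat ?M v seen"
        by auto
      obtain t p where w: "w = Some (t, p)" using submodel_rel[OF M wv(1)] by auto
      obtain t' p' where v: "v = Some (t', p')" using step submodel_rel[OF M wv(2)] w by blast
      have "(None, v) \<in> rel ?M sa" using seen_imp_root_arrow[OF M] wv(4) v by blast
      with wv(3) show "sat ?M None (Dia sa marked)" by auto
    qed
  qed
  have 5: "sat (update (grid_model n) U) (Some (t, p)) (Imp (Dia a marked) (Box a marked))" for U t p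
    using det submodel_rel[OF submodel_update[OF submodel_refl]] by (auto; blast)
  show ?thesis
    unfolding closed_under_def sat_conjs
    using serial m seen 4 5 by (auto simp del: sat_Dia sat_Imp)
qed

section \<open>The grid model satisfies the encoding\<close>

lemma grid_grid_model: "sat (grid_model n) None grid"
proof -
  have "sat (update (grid_model n) U) (Some (t, p))
      (Imp (Dia ra (Dia ua marked)) (Box ua (Box ra marked)))" for U t p
    by (auto dest!: submodel_step[OF submodel_update[OF submodel_refl]])
  moreover have "sat (grid_model n) w marked" for w by (simp add: marked_def)
  ultimately show ?thesis
    unfolding grid_def sat_conjs using closed_under_grid_model
    by (auto simp del: sat_Dia sat_Imp)
qed

lemma rules_grid_model:
  assumes "fst (config c n t) \<noteq> []"
  shows "sat (grid_model n) (Some (t, p)) (rules Q N)"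
  unfolding sat_rules
proof (intro conjI ballI allI impI)
  fix q
  show "sat (grid_model n) (Some (t, p)) (control q)"
    using assms by (cases q rule: control.cases) (cases "config c n t"; auto simp: config_Suc)+
  show "sat (grid_model n) (Some (t, p)) (spread q)" by (simp add: spread_def)
  fix l
  show "sat (grid_model n) (Some (t, p)) (transfer q l (rhs_at q l))"
    using step_reg[OF assms, of l] by (cases "rhs_at q l") auto
qed simp_all

lemma input_grid_model: "p + m = n \<Longrightarrow> sat (grid_model n) (Some (0, p)) (input m)"
  by (induction m arbitrary: p) (auto simp: config_def input_state_def)

theorem diverges_complete:
  assumes "\<And>t. fst (config c n t) \<noteq> []"
  shows "sat (grid_model n) None (diverges Q N c n)"
proof -
  have "sat (grid_model n) (Some (0, 0)) (start c N)"
    by (auto simp: start_def config_def input_state_def)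
  moreover have "sat (grid_model n) (Some (0, 0)) (input n)" by (rule input_grid_model) simp
  ultimately have "sat (grid_model n) None (Dia sa (Conj (start c N) (input n)))"
    unfolding sat_Dia sat.simps(3) rel_grid_model by blast
  moreover have "sat (grid_model n) None (Box sa (rules Q N))"
    using rules_grid_model assms by auto
  ultimately show ?thesis unfolding diverges_def sat.simps(3) using grid_grid_model by blast
qed

section \<open>Correctness and computability of the reduction\<close>

theorem satisfiable_diverges:
  assumes "countable (UNIV :: 'p set)" "countable (UNIV :: 'a set)" "infinite (UNIV :: 'w set)"
  shows "satisfiable TYPE('w) (diverges Q N c n) \<longleftrightarrow> \<not> (\<exists>t. exec c (input_state n) t)"
proof -
  have "satisfiable TYPE('w) (diverges Q N c n) \<longleftrightarrow> (\<forall>t. fst (config c n t) \<noteq> [])"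
  proof
    assume "satisfiable TYPE('w) (diverges Q N c n)"
    then obtain M :: "('w, 'a, 'p) model" and w where sat: "sat M w (diverges Q N c n)"
      by (auto simp: satisfiable_def)
    show "\<forall>t. fst (config c n t) \<noteq> []" by (rule allI, rule diverges_sound[OF sat])
  next
    assume *: "\<forall>t. fst (config c n t) \<noteq> []"
    have "kripke_model (grid_model n)" by (simp add: kripke_model_def grid_model_def)
    moreover have "None \<in> worlds (grid_model n)" by (simp add: grid_model_def)
    ultimately have "satisfiable TYPE((nat \<times> nat) option) (diverges Q N c n)"
      using diverges_complete * unfolding satisfiable_def by blast
    \<comment> \<open>The grid model has its own type of states; the downward Loewenheim-Skolem
      argument moves satisfiability to \<open>'w\<close>.\<close>
    then show "satisfiable TYPE('w) (diverges Q N c n)"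
      by (rule satisfiable_state_type[OF assms])
  qed
  then show ?thesis using halts_iff_exec[of c "input_state n"] by (auto simp: config_def)
qed

text \<open>For a fixed machine only \<open>input n\<close> varies with \<open>n\<close>, and its
  code arises by primitive recursion; all other parts contribute constants.\<close>

lemma computable_diverges: "computable (\<lambda>n. fm_code nP nA (diverges Q N c n))"
proof -
  have "fm_code nP nA (input n) = rec_nat (fm_code nP nA (Neg (reg 0)))
      (\<lambda>_ y. prod_encode (2, prod_encode (fm_code nP nA (reg 0), prod_encode (3, prod_encode (nA ua, y))))) n" for n
    by (induction n) auto
  moreover have "total_rec 1 (\<lambda>v. rec_nat (fm_code nP nA (Neg (reg 0)))
      (\<lambda>_ y. prod_encode (2, prod_encode (fm_code nP nA (reg 0), prod_encode (3, prod_encode (nA ua, y))))) (v ! 0))"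
    by (rule total_rec_rec_nat[where H = "\<lambda>v. prod_encode (2, prod_encode (fm_code nP nA (reg 0), prod_encode (3, prod_encode (nA ua, v ! 1))))"])
      (simp_all add: total_rec_const total_rec_nth total_rec_prod_encode del: fm_code.simps)
  ultimately have "total_rec 1 (\<lambda>v. fm_code nP nA (input (v ! 0)))" by simp
  then show ?thesis
    unfolding diverges_def Dia_def fm_code.simps
    by (intro total_rec_imp_computable total_rec_prod_encode total_rec_const)
qed

end

section \<open>Hardness and undecidability\<close>

theorem mainTheorem1:
  fixes nP :: "'p \<Rightarrow> nat" and nA :: "'a::finite \<Rightarrow> nat"
  assumes "bij nP" and "inj nA" and "card (UNIV :: 'a set) \<ge> 6"
    and "infinite (UNIV :: 'w set)"
  shows "co_RE_hard (fm_code nP nA ` {\<phi>. satisfiable TYPE('w) \<phi>}) \<and>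
         \<not> decidable (fm_code nP nA ` {\<phi>. satisfiable TYPE('w) \<phi>})"
proof -
  let ?B = "fm_code nP nA ` {\<phi>. satisfiable TYPE('w) \<phi>}"
  obtain as :: "'a list" where as: "set as = UNIV" "distinct as"
    using finite_distinct_list[OF finite_UNIV] by blast
  have "length as \<ge> 6" using assms(3) as distinct_card by metis
  then have "as ! i = as ! j \<longleftrightarrow> i = j" if "i < 6" "j < 6" for i j
    using that nth_eq_iff_index_eq[OF as(2)] by auto
  then have "distinct [as ! 0, as ! 1, as ! 2, as ! 3]" by simp
  \<comment> \<open>Countably many symbols are numbered, and \<open>nP\<close> being a bijection
    turns the numbers into distinct propositional variables.\<close>
  moreover have "inj (inv nP \<circ> (to_nat :: sym \<Rightarrow> nat))"
    using assms(1) by (intro inj_compose) (simp_all add: bij_imp_bij_inv bij_is_inj)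
  ultimately have encoding: "encoding (inv nP \<circ> to_nat) (as ! 0) (as ! 1) (as ! 2) (as ! 3)"
    by unfold_locales
  have count: "countable (UNIV :: 'p set)" "countable (UNIV :: 'a set)"
    using assms(1) by (auto intro: countableI bij_is_inj)
  have "co_RE_hard ?B"
    unfolding co_RE_hard_def
  proof (intro allI impI)
    fix A
    assume "recursively_enumerable (- A)"
    then obtain r where r: "\<And>n. n \<in> - A \<longleftrightarrow> (\<exists>y. evals r [n] y)"
      by (auto simp: recursively_enumerable_def)
    \<comment> \<open>The argument is in register 0 and the result goes to register 1.\<close>
    define c where "c = compile r [0] 1"
    have c: "(\<exists>t. exec c (input_state n) t) \<longleftrightarrow> n \<in> - A" for n
      unfolding c_def r by (subst compile_correct) (auto simp: input_state_def)
    obtain Q where Q: "set Q = insert [] (conts c [])"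
      using finite_list[of "insert [] (conts c [])"] finite_conts by auto
    obtain N where N: "regs c \<subseteq> {..<N}" using finite_regs finite_nat_iff_bounded by blast
    \<comment> \<open>\<open>Suc N\<close> makes the bound positive, so that the input register 0
      lies below it.\<close>
    interpret machine "inv nP \<circ> to_nat" "as ! 0" "as ! 1" "as ! 2" "as ! 3" Q "Suc N" c
      using encoding Q N by (auto simp: machine_def machine_axioms_def)
    let ?f = "\<lambda>n. fm_code nP nA (diverges Q (Suc N) c n)"
    have "n \<in> A \<longleftrightarrow> ?f n \<in> ?B" for n
    proof -
      have "n \<in> A \<longleftrightarrow> satisfiable TYPE('w) (diverges Q (Suc N) c n)"
        using satisfiable_diverges[OF count assms(4)] c[of n] by auto
      also have "\<dots> \<longleftrightarrow> ?f n \<in> ?B"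
        using inj_fm_code[OF bij_is_inj[OF assms(1)] assms(2)] by (simp add: inj_image_mem_iff)
      finally show ?thesis .
    qed
    then show "many_one_reducible A ?B"
      unfolding many_one_reducible_def using computable_diverges by blast
  qed
  then show ?thesis using co_RE_hard_not_decidable by blast
qed

end
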